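(* Let $k,m,n$ be integers with $1\le k\le m\le n$. Then the antichain polynomial $\mathcal N_{[k]\times[m]\times[n]}(x)$ is palindromic if and only if $(k,m,n)=(1,r,r)$ or $(k,m,n)=(2,r,r+1)$ for some positive integer $r$.
   Context: For a positive integer $k$, $[k]=\{1<\cdots<k\}$ is the $k$-element chain; products carry the componentwise order. The antichain polynomial of a finite poset $Q$ is $\mathcal N_Q(x)=\sum_{\mathcal A}x^{|\mathcal A|}$, the sum over all antichains $\mathcal A$ of $Q$ (sets of pairwise incomparable elements, including the empty set). A polynomial $f(x)=\sum_{j=0}^d a_jx^j$ of degree $d$ with positive coefficients is palindromic if $a_j=a_{d-j}$ for every $0\le j\le d$. *)

theory Defs
  imports "HOL-Computational_Algebra.Polynomial" "HOL-Library.Product_Order"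
begin

text \<open>
  Posets are subsets of a type of class \<open>order\<close>, with the induced order. On product types
  the order is the componentwise one of \<open>HOL-Library.Product_Order\<close>, so a product of posets
  is just the set product.
\<close>

definition antichains :: "'a::order set \<Rightarrow> 'a set set" where
  "antichains Q = {A. A \<subseteq> Q \<and> pairwise (\<lambda>x y. \<not> x \<le> y \<and> \<not> y \<le> x) A}"

text \<open>Meaningful for finite \<open>Q\<close> only.\<close>

definition antichain_poly :: "'a::order set \<Rightarrow> int poly" where
  "antichain_poly Q = (\<Sum>A\<in>antichains Q. monom 1 (card A))"

definition palindromic :: "int poly \<Rightarrow> bool" where
  "palindromic f \<longleftrightarrow>
     (\<forall>j\<le>degree f. coeff f j > 0) \<and>
     (\<forall>j\<le>degree f. coeff f j = coeff f (degree f - j))"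

definition chain_poset :: "nat \<Rightarrow> nat set" where
  "chain_poset k = {1..k}"

end

theory Submission
  imports Defs
begin

text \<open>
  The constant coefficient of the antichain polynomial is \<open>1\<close> and the linear one is \<open>k m n\<close>, so in the
  palindromic case there is a unique antichain of maximal size \<open>d\<close> and there are exactly \<open>k m n\<close>
  antichains of size \<open>d - 1\<close>.

  If \<open>n \<ge> k + m\<close>, two rank levels are antichains of the maximal size \<open>k m\<close>.
  If \<open>n = k + m - 1\<close> and \<open>k \<ge> 3\<close>, lifting (or dually lowering) parts of the middle level, mostly order ideals of
  \<open>[k] \<times> [m]\<close>, produces more than \<open>k m n\<close> antichains of size \<open>k m - 1\<close>.
  If \<open>n < k + m - 1\<close>, a set of points above the middle never has a smaller lower shadow. When there are
  two middle levels, a unique maximal antichain could therefore be pushed below the middle and, by duality,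
  above it. When there is only one, the shadow is strictly larger, so an antichain of size \<open>d - 1\<close>
  misses a point of the middle level or replaces the shadow of a tight set \<open>X\<close>
  (one with \<open>|\<partial>X| = |X| + 1\<close>) by \<open>X\<close>, up to duality.
  A tight set is either a whole level or consists of all points of its level below a point \<open>t\<close> having some
  coordinate \<open>1\<close>; this leaves fewer than \<open>k m n\<close> possibilities.

  For \<open>k = 2\<close>, removing one row at a time gives the antichain polynomial in the determinantal form
  \<open>F\<^sup>2 - P Q\<close> known from pairs of non-intersecting lattice paths, and for \<open>n = m + 1\<close> the polynomial and its
  reversal agree because \<open>F + G = x Q + E\<close> and \<open>F - G\<close> is proportional to \<open>x Q - E\<close>, where \<open>G\<close> and \<open>E\<close> are
  the reversals of \<open>F\<close> and \<open>Q\<close>.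
\<close>

section \<open>Antichain polynomials\<close>

lemma antichains_iff:
  "A \<in> antichains Q \<longleftrightarrow> A \<subseteq> Q \<and> (\<forall>x\<in>A. \<forall>y\<in>A. x \<le> y \<longrightarrow> x = y)"
  unfolding antichains_def pairwise_def by blast

lemma finite_antichains: "finite Q \<Longrightarrow> finite (antichains Q)"
  by (rule finite_subset[of _ "Pow Q"]) (auto simp: antichains_def)

lemma antichains_subset: "A \<in> antichains Q \<Longrightarrow> B \<subseteq> A \<Longrightarrow> B \<in> antichains Q"
  by (auto simp: antichains_iff subset_iff)

lemma finite_antichain: "finite Q \<Longrightarrow> A \<in> antichains Q \<Longrightarrow> finite A"
  by (auto simp: antichains_iff dest: finite_subset)

lemma coeff_antichain_poly:
  assumes "finite Q"
  shows "coeff (antichain_poly Q) j = int (card {A \<in> antichains Q. card A = j})"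
proof -
  have "coeff (antichain_poly Q) j = (\<Sum>A\<in>antichains Q. if card A = j then 1 else 0)"
    by (simp add: antichain_poly_def coeff_sum)
  also have "\<dots> = int (card {A \<in> antichains Q. card A = j})"
    using finite_antichains[OF assms] by (simp add: sum.If_cases Int_def)
  finally show ?thesis .
qed

lemma coeff_antichain_poly_0:
  assumes "finite Q"
  shows "coeff (antichain_poly Q) 0 = 1"
proof -
  have "{A \<in> antichains Q. card A = 0} = {{}}"
  proof (intro equalityI subsetI)
    fix A assume "A \<in> {A \<in> antichains Q. card A = 0}"
    then show "A \<in> {{}}" using finite_antichain[OF assms, of A] by simp
  qed (simp add: antichains_iff)
  then show ?thesis by (simp add: coeff_antichain_poly[OF assms])
qed

lemma coeff_antichain_poly_1:
  assumes "finite Q"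
  shows "coeff (antichain_poly Q) 1 = int (card Q)"
proof -
  have "{A \<in> antichains Q. card A = 1} = (\<lambda>x. {x}) ` Q"
    by (auto simp: antichains_iff card_1_singleton_iff)
  then show ?thesis by (simp add: coeff_antichain_poly[OF assms] card_image)
qed

lemma degree_antichain_poly:
  assumes "finite Q" "A \<in> antichains Q" "\<forall>B\<in>antichains Q. card B \<le> card A"
  shows "degree (antichain_poly Q) = card A"
proof (rule antisym)
  show "degree (antichain_poly Q) \<le> card A"
  proof (rule degree_le, intro allI impI)
    fix i assume "card A < i"
    then have "{B \<in> antichains Q. card B = i} = {}" using assms(3) by (auto simp: not_le)
    then show "coeff (antichain_poly Q) i = 0"
      by (simp only: coeff_antichain_poly[OF assms(1)] card.empty of_nat_0)
  qed
  have "{B \<in> antichains Q. card B = card A} \<noteq> {}" using assms(2) by blast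
  then have "card {B \<in> antichains Q. card B = card A} \<noteq> 0"
    using finite_antichains[OF assms(1)] by simp
  then show "card A \<le> degree (antichain_poly Q)"
    by (intro le_degree) (simp add: coeff_antichain_poly[OF assms(1)])
qed

lemma max_antichain_exists:
  assumes "finite Q"
  shows "\<exists>A\<in>antichains Q. \<forall>B\<in>antichains Q. card B \<le> card A"
proof -
  have fin: "finite (antichains Q)" and ne: "{} \<in> antichains Q"
    using finite_antichains[OF assms] by (auto simp: antichains_iff)
  have "Max (card ` antichains Q) \<in> card ` antichains Q"
    using fin ne by (intro Max_in) auto
  then obtain A where A: "A \<in> antichains Q" "card A = Max (card ` antichains Q)" by auto
  then have "card B \<le> card A" if "B \<in> antichains Q" for B using fin that by simp
  then show ?thesis using A(1) by blast
qed

text \<open>Subsets of antichains are antichains, so every size up to the maximal one occurs. Hence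
  the positivity clause of \<open>palindromic\<close> always holds and only the symmetry is at
  stake.\<close>

lemma coeff_antichain_poly_pos:
  assumes fin: "finite Q" and "j \<le> degree (antichain_poly Q)"
  shows "coeff (antichain_poly Q) j > 0"
proof -
  obtain A where A: "A \<in> antichains Q" "\<forall>B\<in>antichains Q. card B \<le> card A"
    using max_antichain_exists[OF fin] by blast
  have "j \<le> card A" using assms(2) degree_antichain_poly[OF fin A] by simp
  then obtain B where "B \<subseteq> A" "card B = j" by (rule obtain_subset_with_card_n)
  then have "{B \<in> antichains Q. card B = j} \<noteq> {}" using antichains_subset[OF A(1)] by blast
  then have "card {B \<in> antichains Q. card B = j} \<noteq> 0"
    using finite_antichains[OF fin] by simp
  then show ?thesis
    unfolding coeff_antichain_poly[OF fin] by simp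
qed

lemma palindromic_antichain_polyI:
  assumes "finite Q" "degree (antichain_poly Q) = d"
    and "\<And>j. j \<le> d \<Longrightarrow> coeff (antichain_poly Q) j = coeff (antichain_poly Q) (d - j)"
  shows "palindromic (antichain_poly Q)"
  unfolding palindromic_def assms(2)
proof (intro conjI allI impI)
  fix j assume "j \<le> d"
  then show "coeff (antichain_poly Q) j > 0"
    by (intro coeff_antichain_poly_pos[OF assms(1)]) (simp only: assms(2))
qed (rule assms(3))

text \<open>The leading coefficient equals the constant one, and that counts only the empty
  antichain.\<close>

lemma palindromic_unique_max:
  assumes "finite Q" "palindromic (antichain_poly Q)"
    and "A \<in> antichains Q" "\<forall>B\<in>antichains Q. card B \<le> card A"
    and "B \<in> antichains Q" "card A \<le> card B"
  shows "B = A"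
proof -
  let ?S = "{B \<in> antichains Q. card B = card A}"
  have "coeff (antichain_poly Q) 0 = coeff (antichain_poly Q) (card A - 0)"
    using assms(2) unfolding palindromic_def degree_antichain_poly[OF assms(1,3,4)] by blast
  then have "card ?S = 1"
    unfolding coeff_antichain_poly_0[OF assms(1)] unfolding coeff_antichain_poly[OF assms(1)] by simp
  moreover have "A \<in> ?S" using assms(3) by simp
  moreover have "B \<in> ?S" using assms(4-6) by (auto intro: antisym)
  ultimately show ?thesis by (metis card_1_singletonE singletonD)
qed

text \<open>The coefficient next to the leading one equals the linear one, which counts singletons.
  For \<open>k \<ge> 3\<close>, both \<open>n = k + m - 1\<close> and the case of a single middle
  level are excluded by contradicting this count.\<close>

lemma palindromic_second_coeff:
  assumes "finite Q" "palindromic (antichain_poly Q)"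
    and "A \<in> antichains Q" "\<forall>B\<in>antichains Q. card B \<le> card A" "card A \<ge> 1"
  shows "card {B \<in> antichains Q. card B = card A - 1} = card Q"
proof -
  have "coeff (antichain_poly Q) 1 = coeff (antichain_poly Q) (card A - 1)"
    using assms(2,5) unfolding palindromic_def degree_antichain_poly[OF assms(1,3,4)] by blast
  then show ?thesis
    unfolding coeff_antichain_poly_1[OF assms(1)] unfolding coeff_antichain_poly[OF assms(1)] by simp
qed

text \<open>An antichain meets the chain \<open>C\<close> in at most one element. If it contains
  \<open>e \<in> C\<close>, the rest is an arbitrary antichain among the elements incomparable to
  \<open>e\<close>.\<close>

lemma antichain_poly_chain_split:
  assumes fin: "finite Q" and C: "C \<subseteq> Q" "\<And>x y. x \<in> C \<Longrightarrow> y \<in> C \<Longrightarrow> x \<le> y \<or> y \<le> x"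
  shows "antichain_poly Q = antichain_poly (Q - C) +
    monom 1 1 * (\<Sum>e\<in>C. antichain_poly {z \<in> Q. \<not> z \<le> e \<and> \<not> e \<le> z})"
proof -
  let ?K = "\<lambda>e. {z \<in> Q. \<not> z \<le> e \<and> \<not> e \<le> z}"
  let ?H = "\<lambda>e. insert e ` antichains (?K e)"
  have finC: "finite C" using C(1) fin by (rule finite_subset)
  have split: "antichains Q = antichains (Q - C) \<union> (\<Union>e\<in>C. ?H e)"
  proof (intro equalityI subsetI)
    fix A assume A: "A \<in> antichains Q"
    show "A \<in> antichains (Q - C) \<union> (\<Union>e\<in>C. ?H e)"
    proof (cases "A \<inter> C = {}")
      case True
      then show ?thesis using A by (auto simp: antichains_iff)
    next
      case False
      then obtain e where e: "e \<in> A" "e \<in> C" by auto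
      then have "A - {e} \<in> antichains (?K e)" using A by (auto simp: antichains_iff)
      moreover have "A = insert e (A - {e})" using e by auto
      ultimately show ?thesis using e by blast
    qed
  next
    fix A assume "A \<in> antichains (Q - C) \<union> (\<Union>e\<in>C. ?H e)"
    then show "A \<in> antichains Q" using C(1) by (auto simp: antichains_iff)
  qed
  have disj1: "antichains (Q - C) \<inter> (\<Union>e\<in>C. ?H e) = {}"
    by (auto simp: antichains_iff)
  have disj2: "?H e \<inter> ?H e' = {}" if "e \<in> C" "e' \<in> C" "e \<noteq> e'" for e e'
  proof (rule ccontr)
    assume "?H e \<inter> ?H e' \<noteq> {}"
    then obtain A B where "A \<in> antichains (?K e)" "insert e A = insert e' B" by auto
    then have "e' \<in> ?K e" using that(3) by (auto simp: antichains_iff)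
    then show False using C(2)[OF that(1,2)] by auto
  qed
  have finK: "finite (antichains (?K e))" for e by (rule finite_antichains) (use fin in simp)
  have "antichain_poly Q = antichain_poly (Q - C) + (\<Sum>A\<in>(\<Union>e\<in>C. ?H e). monom 1 (card A))"
    unfolding antichain_poly_def split
    by (rule sum.union_disjoint) (use fin finC finK disj1 in \<open>auto intro: finite_antichains\<close>)
  also have "(\<Sum>A\<in>(\<Union>e\<in>C. ?H e). monom (1::int) (card A)) = (\<Sum>e\<in>C. \<Sum>A\<in>?H e. monom 1 (card A))"
    by (rule sum.UNION_disjoint) (use finC finK disj2 in auto)
  also have "\<dots> = (\<Sum>e\<in>C. monom 1 1 * antichain_poly (?K e))"
  proof (rule sum.cong[OF refl])
    fix e assume "e \<in> C"
    have notin: "e \<notin> A" if "A \<in> antichains (?K e)" for A using that by (auto simp: antichains_iff)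
    have inj: "inj_on (insert e) (antichains (?K e))"
      by (rule inj_onI) (use notin in \<open>metis insert_ident\<close>)
    have "card (insert e A) = Suc (card A)" if "A \<in> antichains (?K e)" for A
      using notin[OF that] that finite_antichain[of "?K e" A] fin by (simp add: card_insert_disjoint)
    then show "(\<Sum>A\<in>?H e. monom 1 (card A)) = monom (1::int) 1 * antichain_poly (?K e)"
      by (simp add: sum.reindex[OF inj] antichain_poly_def sum_distrib_left mult_monom)
  qed
  finally show ?thesis by (simp add: sum_distrib_left)
qed

section \<open>Two-level posets\<close>

text \<open>These are the posets that arise from \<open>[2] \<times> [m] \<times> [n]\<close> when
  rows are removed from the front: \<open>i\<close> and \<open>j\<close> count the rows already gone
  in the lower and the upper layer, while \<open>y\<close> and \<open>v\<close> are the column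
  bounds that the elements chosen so far leave.\<close>

definition two_level :: "nat \<Rightarrow> nat \<Rightarrow> nat \<Rightarrow> nat \<Rightarrow> nat \<Rightarrow> (nat \<times> nat \<times> nat) set" where
  "two_level m i j y v = {1} \<times> {i<..m} \<times> {1..y} \<union> {2} \<times> {j<..m} \<times> {1..v}"

lemma in_two_level:
  "(l, r, c) \<in> two_level m i j y v \<longleftrightarrow>
    1 \<le> c \<and> r \<le> m \<and> (l = 1 \<and> i < r \<and> c \<le> y \<or> l = 2 \<and> j < r \<and> c \<le> v)"
  by (auto simp: two_level_def)

lemma finite_two_level: "finite (two_level m i j y v)"
  by (simp add: two_level_def)

lemma antichain_poly_row_split:
  fixes Q :: "(nat \<times> nat \<times> nat) set"
  assumes "finite Q" "\<And>c. c < y \<Longrightarrow> (l, i, Suc c) \<in> Q"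
  shows "antichain_poly Q = antichain_poly (Q - (\<lambda>c. (l, i, Suc c)) ` {..<y}) +
    monom 1 1 * (\<Sum>c<y. antichain_poly {z \<in> Q. \<not> z \<le> (l, i, Suc c) \<and> \<not> (l, i, Suc c) \<le> z})"
proof -
  let ?f = "\<lambda>c. (l, i, Suc c)"
  have inj: "inj_on ?f {..<y}" by (simp add: inj_on_def)
  have "antichain_poly Q = antichain_poly (Q - ?f ` {..<y}) +
    monom 1 1 * (\<Sum>e\<in>?f ` {..<y}. antichain_poly {z \<in> Q. \<not> z \<le> e \<and> \<not> e \<le> z})"
    using assms by (intro antichain_poly_chain_split) auto
  then show ?thesis by (simp only: sum.reindex[OF inj] comp_def)
qed

text \<open>An element chosen in column \<open>c + 1\<close> of the first lower row lies below
  everything further right in the later lower rows and in all upper rows. Both column bounds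
  therefore drop to at most \<open>c\<close>.\<close>

lemma two_level_lower_row:
  assumes "i < m"
  shows "antichain_poly (two_level m i i y v) = antichain_poly (two_level m (Suc i) i y v) +
    monom 1 1 * (\<Sum>c<y. antichain_poly (two_level m (Suc i) i c (min v c)))"
proof -
  let ?Q = "two_level m i i y v"
  have 1: "?Q - (\<lambda>c. (1, Suc i, Suc c)) ` {..<y} = two_level m (Suc i) i y v"
  proof (rule set_eqI)
    fix z :: "nat \<times> nat \<times> nat"
    obtain l r c where z: "z = (l, r, c)" by (cases z)
    have "(z \<in> (\<lambda>c. (1, Suc i, Suc c)) ` {..<y}) \<longleftrightarrow> l = 1 \<and> r = Suc i \<and> 1 \<le> c \<and> c \<le> y"
      unfolding z by (cases c) auto
    then show "z \<in> ?Q - (\<lambda>c. (1, Suc i, Suc c)) ` {..<y} \<longleftrightarrow> z \<in> two_level m (Suc i) i y v"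
      unfolding Diff_iff unfolding z in_two_level by auto
  qed
  have 2: "{z \<in> ?Q. \<not> z \<le> (1, Suc i, Suc c) \<and> \<not> (1, Suc i, Suc c) \<le> z} =
      two_level m (Suc i) i c (min v c)" if "c < y" for c
  proof (rule set_eqI)
    fix z :: "nat \<times> nat \<times> nat"
    obtain l r d where z: "z = (l, r, d)" by (cases z)
    show "z \<in> {z \<in> ?Q. \<not> z \<le> (1, Suc i, Suc c) \<and> \<not> (1, Suc i, Suc c) \<le> z} \<longleftrightarrow>
        z \<in> two_level m (Suc i) i c (min v c)"
      unfolding z mem_Collect_eq in_two_level Pair_le using that by auto
  qed
  have "antichain_poly ?Q = antichain_poly (?Q - (\<lambda>c. (1, Suc i, Suc c)) ` {..<y}) +
    monom 1 1 * (\<Sum>c<y. antichain_poly {z \<in> ?Q. \<not> z \<le> (1, Suc i, Suc c) \<and> \<not> (1, Suc i, Suc c) \<le> z})"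
    by (rule antichain_poly_row_split) (use assms in \<open>simp_all add: finite_two_level in_two_level\<close>)
  also have "(\<Sum>c<y. antichain_poly {z \<in> ?Q. \<not> z \<le> (1, Suc i, Suc c) \<and> \<not> (1, Suc i, Suc c) \<le> z}) =
      (\<Sum>c<y. antichain_poly (two_level m (Suc i) i c (min v c)))"
    by (rule sum.cong[OF refl]) (simp only: 2 lessThan_iff)
  finally show ?thesis unfolding 1 .
qed

text \<open>The lower rows still present come after row \<open>i + 1\<close>, so their elements are
  incomparable to any element of that upper row. Only the upper bound drops.\<close>

lemma two_level_upper_row:
  assumes "i < m"
  shows "antichain_poly (two_level m (Suc i) i y v) = antichain_poly (two_level m (Suc i) (Suc i) y v) +
    monom 1 1 * (\<Sum>c<v. antichain_poly (two_level m (Suc i) (Suc i) y c))"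
proof -
  let ?Q = "two_level m (Suc i) i y v"
  have 1: "?Q - (\<lambda>c. (2, Suc i, Suc c)) ` {..<v} = two_level m (Suc i) (Suc i) y v"
  proof (rule set_eqI)
    fix z :: "nat \<times> nat \<times> nat"
    obtain l r c where z: "z = (l, r, c)" by (cases z)
    have "(z \<in> (\<lambda>c. (2, Suc i, Suc c)) ` {..<v}) \<longleftrightarrow> l = 2 \<and> r = Suc i \<and> 1 \<le> c \<and> c \<le> v"
      unfolding z by (cases c) auto
    then show "z \<in> ?Q - (\<lambda>c. (2, Suc i, Suc c)) ` {..<v} \<longleftrightarrow> z \<in> two_level m (Suc i) (Suc i) y v"
      unfolding Diff_iff unfolding z in_two_level by auto
  qed
  have 2: "{z \<in> ?Q. \<not> z \<le> (2, Suc i, Suc c) \<and> \<not> (2, Suc i, Suc c) \<le> z} =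
      two_level m (Suc i) (Suc i) y c" if "c < v" for c
  proof (rule set_eqI)
    fix z :: "nat \<times> nat \<times> nat"
    obtain l r d where z: "z = (l, r, d)" by (cases z)
    show "z \<in> {z \<in> ?Q. \<not> z \<le> (2, Suc i, Suc c) \<and> \<not> (2, Suc i, Suc c) \<le> z} \<longleftrightarrow>
        z \<in> two_level m (Suc i) (Suc i) y c"
      unfolding z mem_Collect_eq in_two_level Pair_le using that by auto
  qed
  have "antichain_poly ?Q = antichain_poly (?Q - (\<lambda>c. (2, Suc i, Suc c)) ` {..<v}) +
    monom 1 1 * (\<Sum>c<v. antichain_poly {z \<in> ?Q. \<not> z \<le> (2, Suc i, Suc c) \<and> \<not> (2, Suc i, Suc c) \<le> z})"
    by (rule antichain_poly_row_split) (use assms in \<open>simp_all add: finite_two_level in_two_level\<close>)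
  also have "(\<Sum>c<v. antichain_poly {z \<in> ?Q. \<not> z \<le> (2, Suc i, Suc c) \<and> \<not> (2, Suc i, Suc c) \<le> z}) =
      (\<Sum>c<v. antichain_poly (two_level m (Suc i) (Suc i) y c))"
    by (rule sum.cong[OF refl]) (simp only: 2 lessThan_iff)
  finally show ?thesis unfolding 1 .
qed

section \<open>Determinantal formula for two-level posets\<close>

definition gpoly :: "nat \<Rightarrow> nat \<Rightarrow> int poly" where
  "gpoly r y = (\<Sum>i\<le>r. monom (int ((r choose i) * (y choose i))) i)"

text \<open>One off-diagonal entry of the determinant; the diagonal entry \<open>gpoly r y\<close>
  is the antichain polynomial of \<open>[r] \<times> [y]\<close>. At \<open>r = 0\<close> the
  truncated \<open>r - 1\<close> gives a wrong value, which is harmless since it is multiplied by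
  \<open>ppoly 0 y = 0\<close>.\<close>

definition qpoly :: "nat \<Rightarrow> nat \<Rightarrow> int poly" where
  "qpoly r v = (\<Sum>i\<le>r. monom (int ((r - 1 choose i) * (v + 1 choose (i + 2)))) i)"

text \<open>For \<open>y = 0\<close> the truncated \<open>y - 1\<close> gives a junk value, which only ever occurs multiplied by
  \<open>qpoly r 0 = 0\<close>.\<close>

definition ppoly :: "nat \<Rightarrow> nat \<Rightarrow> int poly" where
  "ppoly r y = (\<Sum>i\<le>r. monom (int ((r + 1 choose (i + 2)) * (y - 1 choose i))) (i + 2))"

lemma coeff_sum_monom: "coeff (\<Sum>i\<le>n. monom (f i) i) j = (if j \<le> n then f j else 0)"
  by (simp add: coeff_sum if_distrib[where f = "\<lambda>p. coeff p j"] sum.delta' cong: if_cong)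

lemma coeff_gpoly: "coeff (gpoly r y) i = int ((r choose i) * (y choose i))"
  by (simp add: gpoly_def coeff_sum_monom binomial_eq_0)

lemma coeff_qpoly: "coeff (qpoly r v) i = int ((r - 1 choose i) * (v + 1 choose (i + 2)))"
  by (simp add: qpoly_def coeff_sum_monom binomial_eq_0 del: binomial_Suc_Suc)

lemma ppoly_alt: "ppoly r y = monom 1 2 * (\<Sum>i\<le>r. monom (int ((r + 1 choose (i + 2)) * (y - 1 choose i))) i)"
  by (simp add: ppoly_def sum_distrib_left mult_monom add.commute)

lemma coeff_ppoly: "coeff (ppoly r y) i = (if i < 2 then 0 else int ((r + 1 choose i) * (y - 1 choose (i - 2))))"
proof (cases "i < 2")
  case False
  then obtain j where "i = j + 2" by (metis add.commute le_Suc_ex not_less)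
  then show ?thesis
    unfolding ppoly_alt coeff_monom_mult coeff_sum_monom by (simp add: binomial_eq_0 del: binomial_Suc_Suc)
qed (simp add: ppoly_alt coeff_monom_mult)

abbreviation xpoly :: "int poly" where "xpoly \<equiv> monom 1 1"

lemma coeff_xpoly_mult:
  "coeff (monom 1 (Suc 0) * p) i = (if i = 0 then 0 else coeff p (i - 1))"
  "coeff (p * monom 1 (Suc 0)) i = (if i = 0 then 0 else coeff p (i - 1))"
  for p :: "int poly"
  by (simp_all add: coeff_monom_mult mult.commute[of p])

text \<open>Pascal's rule in both arguments: the mixed second difference multiplies the two
  differences of binomials, which lowers both lower indices and so amounts to a factor
  \<open>x\<close>. The two other families satisfy the same recurrence away from their truncated
  arguments.\<close>

lemma gpoly_rec: "gpoly (Suc r) (Suc y) = gpoly (Suc r) y + gpoly r (Suc y) - gpoly r y + xpoly * gpoly r y"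
proof (rule poly_eqI)
  fix i
  show "coeff (gpoly (Suc r) (Suc y)) i = coeff (gpoly (Suc r) y + gpoly r (Suc y) - gpoly r y + xpoly * gpoly r y) i"
    by (cases i) (simp_all add: coeff_xpoly_mult coeff_gpoly algebra_simps)
qed

lemma qpoly_rec:
  assumes "r \<ge> 1"
  shows "qpoly (Suc r) (Suc y) = qpoly (Suc r) y + qpoly r (Suc y) - qpoly r y + xpoly * qpoly r y"
proof (rule poly_eqI)
  fix i
  obtain s where r: "r = Suc s" using assms by (cases r) auto
  show "coeff (qpoly (Suc r) (Suc y)) i = coeff (qpoly (Suc r) y + qpoly r (Suc y) - qpoly r y + xpoly * qpoly r y) i"
    by (cases i) (simp_all add: r coeff_xpoly_mult coeff_qpoly algebra_simps)
qed

lemma ppoly_rec: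
  assumes "y \<ge> 1"
  shows "ppoly (Suc r) (Suc y) = ppoly (Suc r) y + ppoly r (Suc y) - ppoly r y + xpoly * ppoly r y"
proof (rule poly_eqI)
  fix i
  obtain z where y: "y = Suc z" using assms by (cases y) auto
  show "coeff (ppoly (Suc r) (Suc y)) i = coeff (ppoly (Suc r) y + ppoly r (Suc y) - ppoly r y + xpoly * ppoly r y) i"
  proof (cases "i \<le> 2")
    case True
    then have "i = 0 \<or> i = 1 \<or> i = 2" by auto
    then show ?thesis
      by (elim disjE) (simp_all add: y coeff_xpoly_mult coeff_ppoly numeral_2_eq_2)
  next
    case False
    then obtain j where "i = Suc (Suc (Suc j))" by (metis Suc_leI add_Suc less_imp_Suc_add not_le numeral_2_eq_2 plus_nat.simps)
    then show ?thesis
      by (simp add: y coeff_xpoly_mult coeff_ppoly algebra_simps)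
  qed
qed

text \<open>Together with \<open>ppoly_row_diff\<close> this links row differences to column
  differences, and makes a 2 by 2 minor of differences vanish in
  \<open>two_level_poly_step_diag\<close>.\<close>

lemma gpoly_row_diff: "gpoly (Suc r) (Suc y) - gpoly r (Suc y) = xpoly * (qpoly (Suc r) (Suc y) - qpoly (Suc r) y)"
proof (rule poly_eqI)
  fix i
  show "coeff (gpoly (Suc r) (Suc y) - gpoly r (Suc y)) i = coeff (xpoly * (qpoly (Suc r) (Suc y) - qpoly (Suc r) y)) i"
    by (cases i) (simp_all add: coeff_xpoly_mult coeff_gpoly coeff_qpoly algebra_simps)
qed

lemma ppoly_row_diff: "ppoly (Suc r) (Suc y) - ppoly r (Suc y) = xpoly * (gpoly (Suc r) (Suc y) - gpoly (Suc r) y)"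
proof (rule poly_eqI)
  fix i
  consider "i = 0" | "i = 1" | j where "i = Suc (Suc j)" by (metis One_nat_def not0_implies_Suc)
  then show "coeff (ppoly (Suc r) (Suc y) - ppoly r (Suc y)) i = coeff (xpoly * (gpoly (Suc r) (Suc y) - gpoly (Suc r) y)) i"
    by cases (simp_all add: coeff_xpoly_mult coeff_gpoly coeff_ppoly algebra_simps)
qed

lemma gpoly_0: "gpoly r 0 = 1"
  by (rule poly_eqI) (auto simp: coeff_gpoly)

lemma gpoly_row_0: "gpoly 0 y = 1"
  by (rule poly_eqI) (auto simp: coeff_gpoly)

lemma qpoly_0: "qpoly r 0 = 0"
  by (rule poly_eqI) (auto simp: coeff_qpoly binomial_eq_0)

lemma ppoly_row_0: "ppoly 0 y = 0"
  by (rule poly_eqI) (auto simp: coeff_ppoly binomial_eq_0)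

lemma gpoly_sum: "gpoly (Suc r) v = gpoly r v + xpoly * (\<Sum>c<v. gpoly r c)"
  by (induction v) (simp_all add: gpoly_0 gpoly_rec algebra_simps)

lemma qpoly_sum: "r \<ge> 1 \<Longrightarrow> qpoly (Suc r) v = qpoly r v + xpoly * (\<Sum>c<v. qpoly r c)"
  by (induction v) (simp_all add: qpoly_0 qpoly_rec algebra_simps)

text \<open>The intermediate determinant, for \<open>r\<close> lower rows and \<open>r + 1\<close>
  upper rows: a lower row has been removed and its upper partner has not.\<close>

definition upper_step :: "nat \<Rightarrow> nat \<Rightarrow> nat \<Rightarrow> int poly" where
  "upper_step r y v = gpoly r y * gpoly (Suc r) v - ppoly r y * qpoly (Suc r) v"

definition two_level_poly :: "nat \<Rightarrow> nat \<Rightarrow> nat \<Rightarrow> int poly" where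
  "two_level_poly r y v = gpoly r y * gpoly r v - ppoly r y * qpoly r v"

lemma upper_step_sum:
  "upper_step r y v = two_level_poly r y v + xpoly * (\<Sum>c<v. two_level_poly r y c)"
proof -
  have *: "(\<Sum>c<v. two_level_poly r y c) = gpoly r y * (\<Sum>c<v. gpoly r c) - ppoly r y * (\<Sum>c<v. qpoly r c)"
    by (simp add: two_level_poly_def sum_subtractf sum_distrib_left)
  show ?thesis
    unfolding *
    by (cases "r = 0")
      (simp_all add: upper_step_def two_level_poly_def gpoly_sum qpoly_sum ppoly_row_0 algebra_simps)
qed

lemma two_level_poly_step_y:
  assumes "v \<le> y"
  shows "two_level_poly (Suc r) (Suc y) v =
    two_level_poly (Suc r) y v + upper_step r (Suc y) v - upper_step r y v + xpoly * upper_step r y v"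
proof (cases "y = 0")
  \<comment> \<open>The recurrence of \<open>ppoly\<close> fails at \<open>y = 0\<close>, but then
    \<open>v = 0\<close> as well and \<open>qpoly\<close> removes the term.\<close>
  case True
  then show ?thesis using assms
    by (simp add: two_level_poly_def upper_step_def qpoly_0 gpoly_0 gpoly_rec)
next
  case False
  then have "y \<ge> 1" by simp
  then show ?thesis
    by (simp add: two_level_poly_def upper_step_def gpoly_rec[of r y] ppoly_rec[of y r] algebra_simps)
qed

text \<open>The two sides differ by a product of differences of \<open>gpoly\<close> minus a product
  of differences of \<open>ppoly\<close> and \<open>qpoly\<close>. By the row difference lemmas both
  products are \<open>x\<close> times the same two column differences.\<close>

lemma two_level_poly_step_diag:
  "two_level_poly (Suc r) (Suc y) (Suc y) - two_level_poly (Suc r) (Suc y) y =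
    upper_step r (Suc y) (Suc y) - upper_step r (Suc y) y"
proof -
  let ?dg = "gpoly (Suc r) (Suc y) - gpoly (Suc r) y"
  let ?dq = "qpoly (Suc r) (Suc y) - qpoly (Suc r) y"
  have "two_level_poly (Suc r) (Suc y) (Suc y) - two_level_poly (Suc r) (Suc y) y
      - (upper_step r (Suc y) (Suc y) - upper_step r (Suc y) y) =
      (gpoly (Suc r) (Suc y) - gpoly r (Suc y)) * ?dg - (ppoly (Suc r) (Suc y) - ppoly r (Suc y)) * ?dq"
    by (simp add: two_level_poly_def upper_step_def algebra_simps)
  also have "\<dots> = 0"
    unfolding gpoly_row_diff ppoly_row_diff by (simp only: mult.assoc mult.commute mult.left_commute diff_self)
  finally show ?thesis by simp
qed

text \<open>The first induction runs along the diagonal \<open>y = v\<close>, where each step moves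
  from \<open>(v, v)\<close> to \<open>(v + 1, v)\<close> and then to \<open>(v + 1, v + 1)\<close>.
  The second one increases \<open>y\<close> alone, where the minimum stays at
  \<open>v\<close>.\<close>

lemma two_level_poly_sum:
  assumes "v \<le> y"
  shows "two_level_poly (Suc r) y v = upper_step r y v + xpoly * (\<Sum>c<y. upper_step r c (min v c))"
proof -
  have diag: "two_level_poly (Suc r) v v = upper_step r v v + xpoly * (\<Sum>c<v. upper_step r c c)" for v
  proof (induction v)
    case 0
    then show ?case by (simp add: two_level_poly_def upper_step_def qpoly_0 gpoly_0)
  next
    case (Suc v)
    have "two_level_poly (Suc r) (Suc v) (Suc v) = two_level_poly (Suc r) (Suc v) v +
        upper_step r (Suc v) (Suc v) - upper_step r (Suc v) v"
      using two_level_poly_step_diag[of r v] by (simp add: algebra_simps)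
    then show ?case
      using Suc two_level_poly_step_y[of v v r] by (simp add: algebra_simps)
  qed
  show ?thesis
    using assms
  proof (induction y rule: dec_induct)
    case base
    have "(\<Sum>c<v. upper_step r c (min v c)) = (\<Sum>c<v. upper_step r c c)"
      by (rule sum.cong) simp_all
    then show ?case using diag by simp
  next
    case (step y)
    then show ?case
      using two_level_poly_step_y[of v y r] by (simp add: algebra_simps min_def)
  qed
qed

text \<open>Induction on the number of rows, removing a lower row and then an upper row. The
  condition \<open>v \<le> y\<close>, under which the determinant counts correctly, survives because
  the new bounds are \<open>c\<close> and \<open>min v c\<close>.\<close>

lemma antichain_poly_two_level:
  assumes "v \<le> y"
  shows "antichain_poly (two_level (i + r) i i y v) = two_level_poly r y v"
  using assms
proof (induction r arbitrary: i y v)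
  case 0
  have "two_level (i + 0) i i y v = {}" by (simp add: two_level_def)
  moreover have "antichains ({} :: (nat \<times> nat \<times> nat) set) = {{}}" by (auto simp: antichains_iff)
  ultimately show ?case
    by (simp add: antichain_poly_def two_level_poly_def gpoly_row_0 ppoly_row_0)
next
  case (Suc r)
  have IH: "antichain_poly (two_level (i + Suc r) (Suc i) (Suc i) y v) = two_level_poly r y v"
    if "v \<le> y" for y v
    using Suc.IH[OF that, of "Suc i"] by simp
  have step: "antichain_poly (two_level (i + Suc r) (Suc i) i y v) = upper_step r y v" if "v \<le> y" for y v
    using that by (simp add: two_level_upper_row upper_step_sum IH[simplified])
  have "antichain_poly (two_level (i + Suc r) i i y v) = upper_step r y v +
      xpoly * (\<Sum>c<y. upper_step r c (min v c))"
    using Suc.prems by (simp add: two_level_lower_row step[simplified])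
  then show ?case using two_level_poly_sum[OF Suc.prems] by simp
qed

section \<open>Grids and the palindromic cases\<close>

abbreviation grid :: "nat \<Rightarrow> nat \<Rightarrow> nat \<Rightarrow> (nat \<times> nat \<times> nat) set" where
  "grid k m n \<equiv> chain_poset k \<times> chain_poset m \<times> chain_poset n"

lemma in_grid: "(a, b, c) \<in> grid k m n \<longleftrightarrow> 1 \<le> a \<and> a \<le> k \<and> 1 \<le> b \<and> b \<le> m \<and> 1 \<le> c \<and> c \<le> n"
  by (auto simp: chain_poset_def)

lemma finite_grid: "finite (grid k m n)"
  by (simp add: chain_poset_def)

lemma card_grid: "card (grid k m n) = k * m * n"
  by (simp add: chain_poset_def card_cartesian_product)

text \<open>Points over the same \<open>(a, b)\<close> are comparable, so an antichain projects
  injectively to the rectangle.\<close>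

lemma grid_width:
  assumes A: "A \<in> antichains (grid k m n)"
  shows "card A \<le> k * m"
proof -
  have eq: "x = y" if "x \<in> A" "y \<in> A" "x \<le> y" for x y
    using A that by (auto simp: antichains_iff)
  have "inj_on (\<lambda>(a, b, c). (a, b)) A"
  proof (rule inj_onI)
    fix x y assume xy: "x \<in> A" "y \<in> A" "(\<lambda>(a, b, c). (a, b)) x = (\<lambda>(a, b, c). (a, b)) y"
    obtain a b c where x: "x = (a, b, c)" by (cases x)
    obtain d where y: "y = (a, b, d)" using xy(3) x by (cases y) auto
    have "x \<le> y \<or> y \<le> x" unfolding x y by auto
    then show "x = y" using eq xy(1,2) by blast
  qed
  moreover have "(\<lambda>(a, b, c). (a, b)) ` A \<subseteq> chain_poset k \<times> chain_poset m"
    using A by (auto simp: antichains_iff)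
  moreover have "finite (chain_poset k \<times> chain_poset m)" by (simp add: chain_poset_def)
  ultimately have "card A \<le> card (chain_poset k \<times> chain_poset m)"
    by (metis card_image card_mono)
  then show ?thesis by (simp add: chain_poset_def card_cartesian_product)
qed

text \<open>Every antichain of a grid is the graph of a strictly decreasing function on a subset of
  the rectangle. Writing it so makes its size and the antichain condition immediate.\<close>

definition graph_set :: "(nat \<times> nat) set \<Rightarrow> (nat \<Rightarrow> nat \<Rightarrow> nat) \<Rightarrow> (nat \<times> nat \<times> nat) set" where
  "graph_set D h = (\<lambda>(a, b). (a, b, h a b)) ` D"

lemma in_graph_set: "(a, b, c) \<in> graph_set D h \<longleftrightarrow> (a, b) \<in> D \<and> c = h a b"
  by (auto simp: graph_set_def)

lemma card_graph_set: "card (graph_set D h) = card D"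
  unfolding graph_set_def by (rule card_image) (auto simp: inj_on_def)

lemma graph_set_antichain:
  assumes "D \<subseteq> chain_poset k \<times> chain_poset m"
    and "\<And>a b. (a, b) \<in> D \<Longrightarrow> 1 \<le> h a b \<and> h a b \<le> n"
    and "\<And>a b a' b'. (a, b) \<in> D \<Longrightarrow> (a', b') \<in> D \<Longrightarrow> a \<le> a' \<Longrightarrow> b \<le> b' \<Longrightarrow> (a, b) \<noteq> (a', b') \<Longrightarrow>
      h a' b' < h a b"
  shows "graph_set D h \<in> antichains (grid k m n)"
  unfolding antichains_iff
proof (intro conjI subsetI ballI impI)
  fix x assume "x \<in> graph_set D h"
  then obtain a b where "x = (a, b, h a b)" "(a, b) \<in> D" by (auto simp: graph_set_def)
  then show "x \<in> grid k m n" using assms(1) assms(2)[of a b] by (auto simp: chain_poset_def)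
next
  fix x y assume xy: "x \<in> graph_set D h" "y \<in> graph_set D h" "x \<le> y"
  obtain a b a' b' where *: "x = (a, b, h a b)" "(a, b) \<in> D" "y = (a', b', h a' b')" "(a', b') \<in> D"
    using xy(1,2) by (auto simp: graph_set_def)
  show "x = y"
  proof (rule ccontr)
    assume "x \<noteq> y"
    then have "(a, b) \<noteq> (a', b')" using * by auto
    then show False using assms(3)[OF *(2,4)] xy(3) * by auto
  qed
qed

text \<open>This is the plane of rank \<open>s\<close>. The bound \<open>k + m < s\<close> keeps its
  heights at least \<open>1\<close>, and \<open>s \<le> n + 2\<close> keeps them at most
  \<open>n\<close>, so the plane covers the whole rectangle.\<close>

lemma diagonal_antichain:
  assumes "k + m < s" "s \<le> n + 2"
  shows "graph_set (chain_poset k \<times> chain_poset m) (\<lambda>a b. s - a - b) \<in> antichains (grid k m n)"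
  by (rule graph_set_antichain) (use assms in \<open>auto simp: chain_poset_def\<close>)

lemma card_diagonal_antichain:
  "card (graph_set (chain_poset k \<times> chain_poset m) h) = k * m"
  by (simp add: card_graph_set chain_poset_def card_cartesian_product)

lemma degree_grid_long:
  assumes "k + m \<le> n + 1"
  shows "degree (antichain_poly (grid k m n)) = k * m"
proof -
  let ?A = "graph_set (chain_poset k \<times> chain_poset m) (\<lambda>a b. (k + m + 1) - a - b)"
  have "?A \<in> antichains (grid k m n)" by (rule diagonal_antichain) (use assms in auto)
  moreover have "\<forall>B\<in>antichains (grid k m n). card B \<le> card ?A"
    using grid_width by (simp add: card_diagonal_antichain)
  ultimately show ?thesis
    using degree_antichain_poly[OF finite_grid] by (simp add: card_diagonal_antichain)
qed

text \<open>Reversal is taken with respect to the formal degrees \<open>a\<close> and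
  \<open>b\<close>, which may exceed the actual ones. It is multiplicative with formal degree
  \<open>a + b\<close>.\<close>

lemma coeff_mult_reverse:
  fixes p q p' q' :: "int poly"
  assumes "degree p \<le> a" "\<And>i. coeff p' i = (if i \<le> a then coeff p (a - i) else 0)"
    and "degree q \<le> b" "\<And>i. coeff q' i = (if i \<le> b then coeff q (b - i) else 0)"
    and "K \<le> a + b"
  shows "coeff (p' * q') K = coeff (p * q) (a + b - K)"
proof (cases "p = 0 \<or> q = 0")
  case True
  then have "p' = 0 \<or> q' = 0" using assms(2,4) by (auto intro: poly_eqI)
  then show ?thesis using True by auto
next
  case False
  \<comment> \<open>Reversal at formal degree \<open>c\<close> is the usual reflection, shifted by
    the gap between \<open>c\<close> and the actual degree.\<close>
  have *: "r' = monom 1 (c - degree r) * reflect_poly r"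
    if "degree r \<le> c" "\<And>i. coeff r' i = (if i \<le> c then coeff r (c - i) else 0)" for r r' :: "int poly" and c
  proof (rule poly_eqI)
    fix i
    show "coeff r' i = coeff (monom 1 (c - degree r) * reflect_poly r) i"
    proof (cases "i < c - degree r")
      case True
      then have "coeff r (c - i) = 0" by (intro coeff_eq_0) simp
      then show ?thesis using True that by (simp add: coeff_monom_mult)
    next
      case False
      have eq: "degree r - (i - (c - degree r)) = c - i" using False that(1) by simp
      show ?thesis unfolding coeff_monom_mult coeff_reflect_poly eq that(2)
        using False that(1) by auto
    qed
  qed
  have deg: "degree (p * q) = degree p + degree q" using False by (simp add: degree_mult_eq)
  have "p' * q' = (monom 1 (a - degree p) * monom 1 (b - degree q)) * (reflect_poly p * reflect_poly q)"
    unfolding *[OF assms(1,2)] *[OF assms(3,4)] by (simp only: mult_ac)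
  also have "monom 1 (a - degree p) * monom 1 (b - degree q) = (monom 1 (a + b - degree (p * q)) :: int poly)"
    using assms(1,3) by (simp add: mult_monom deg)
  finally have pq: "p' * q' = monom 1 (a + b - degree (p * q)) * reflect_poly (p * q)"
    by (simp only: reflect_poly_mult)
  have "degree (p * q) \<le> a + b" using assms(1,3) by (simp add: deg)
  show ?thesis
  proof (cases "K < a + b - degree (p * q)")
    case True
    then have "coeff (p * q) (a + b - K) = 0" by (intro coeff_eq_0) simp
    then show ?thesis using True pq by (simp add: coeff_monom_mult)
  next
    case nlt: False
    have eq: "degree (p * q) - (K - (a + b - degree (p * q))) = a + b - K"
      using nlt \<open>degree (p * q) \<le> a + b\<close> by simp
    show ?thesis unfolding pq coeff_monom_mult coeff_reflect_poly eq
      using nlt \<open>degree (p * q) \<le> a + b\<close> assms(5) by auto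
  qed
qed

text \<open>With an empty upper layer the determinant reduces to \<open>gpoly r r\<close>, whose
  coefficients are the squares of the binomials of \<open>r\<close>.\<close>

lemma palindromic_grid_1:
  assumes "r \<ge> 1"
  shows "palindromic (antichain_poly (grid 1 r r))"
proof -
  have "grid 1 r r = two_level (0 + r) 0 0 r 0"
    by (auto simp: chain_poset_def two_level_def)
  then have eq: "antichain_poly (grid 1 r r) = gpoly r r"
    by (simp only: antichain_poly_two_level[OF le0]) (simp add: two_level_poly_def gpoly_0 qpoly_0)
  show ?thesis
  proof (rule palindromic_antichain_polyI[OF finite_grid])
    show "degree (antichain_poly (grid 1 r r)) = r"
      using degree_grid_long[of 1 r r] by simp
    show "coeff (antichain_poly (grid 1 r r)) j = coeff (antichain_poly (grid 1 r r)) (r - j)" if "j \<le> r" for j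
      using binomial_symmetric[OF that] unfolding eq coeff_gpoly by simp
  qed
qed

section \<open>Reversal identity for \<open>[2] \<times> [r] \<times> [r + 1]\<close>\<close>

definition narayana_shift :: "nat \<Rightarrow> nat \<Rightarrow> nat \<Rightarrow> int poly" where
  "narayana_shift a b s = (\<Sum>i\<le>a. monom (int ((a choose i) * (b choose (i + s)))) i)"

lemma coeff_narayana_shift: "coeff (narayana_shift a b s) i = int ((a choose i) * (b choose (i + s)))"
  by (simp add: narayana_shift_def coeff_sum_monom binomial_eq_0 del: binomial_Suc_Suc)

lemma choose_absorb: "int (Suc i) * int (Suc n choose Suc i) = int (Suc n) * int (n choose i)"
  by (metis Suc_times_binomial of_nat_mult)

lemma choose_absorb_comp:
  assumes "i \<le> Suc n"
  shows "(int (Suc n) - int i) * int (Suc n choose i) = int (Suc n) * int (n choose i)"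
  using binomial_absorb_comp[of "Suc n" i] assms by (metis diff_Suc_1 of_nat_diff of_nat_mult)

text \<open>Here \<open>r = m + 1\<close>. The polynomials \<open>G\<close>, \<open>H\<close> and
  \<open>E\<close> are the reversals of \<open>F\<close>, \<open>P\<close> and \<open>Q\<close> at
  the formal degrees \<open>m + 1\<close>, \<open>m + 2\<close> and \<open>m\<close>.\<close>

context
  fixes m :: nat and F G P Q E H :: "int poly"
  defines "F \<equiv> gpoly (Suc m) (Suc (Suc m))" and "G \<equiv> narayana_shift (Suc m) (Suc (Suc m)) 1"
    and "P \<equiv> ppoly (Suc m) (Suc (Suc m))" and "Q \<equiv> qpoly (Suc m) (Suc (Suc m))"
    and "E \<equiv> narayana_shift m (m + 3) 1" and "H \<equiv> narayana_shift (m + 2) (m + 1) 1"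
begin

text \<open>Both sides have the coefficient
  \<open>(m + 1 choose i) * (m + 3 choose (i + 1))\<close>: Pascal's rule combines the second
  factors on the left and splits the first one on the right.\<close>

lemma F_plus_G: "F + G = xpoly * Q + E"
proof (rule poly_eqI)
  fix i
  show "coeff (F + G) i = coeff (xpoly * Q + E) i"
    by (cases i) (simp_all add: F_def G_def Q_def E_def coeff_xpoly_mult coeff_gpoly
      coeff_qpoly coeff_narayana_shift numeral_3_eq_3 algebra_simps)
qed

text \<open>After multiplication by \<open>m + 3\<close> and \<open>m + 1\<close> the absorption
  identities turn both sides into \<open>2 * i - m - 1\<close> times
  \<open>(m + 1 choose i) * (m + 3 choose (i + 1))\<close>.\<close>

lemma F_minus_G: "smult (int (m + 3)) (F - G) = smult (int (m + 1)) (xpoly * Q - E)"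
proof (rule poly_eqI)
  fix i
  show "coeff (smult (int (m + 3)) (F - G)) i = coeff (smult (int (m + 1)) (xpoly * Q - E)) i"
  proof (cases "i \<le> Suc m")
    case False
    then show ?thesis
      by (cases i) (simp_all add: F_def G_def Q_def E_def coeff_xpoly_mult coeff_gpoly
        coeff_qpoly coeff_narayana_shift binomial_eq_0)
  next
    case True
    let ?c = "int (Suc m choose i)" and ?d = "int (m + 3 choose Suc i)"
    have 1: "int (m + 3) * int (m + 2 choose i) = int (Suc i) * ?d"
      using choose_absorb[of i "m + 2"] by (simp add: numeral_3_eq_3 del: binomial_Suc_Suc)
    have 2: "int (m + 3) * int (m + 2 choose Suc i) = (int (m + 3) - int (Suc i)) * ?d"
      using choose_absorb_comp[of "Suc i" "m + 2"] True by (simp add: numeral_3_eq_3 del: binomial_Suc_Suc)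
    have 3: "int (m + 1) * int (m choose i) = (int (m + 1) - int i) * ?c"
      using choose_absorb_comp[of i m] True by (simp del: binomial_Suc_Suc)
    have 4: "int (m + 1) * (if i = 0 then 0 else int (m choose (i - 1))) = int i * ?c"
      using choose_absorb[of "i - 1" m] by (cases i) (simp_all del: binomial_Suc_Suc)
    have "coeff (smult (int (m + 3)) (F - G)) i =
        ?c * (int (m + 3) * int (m + 2 choose i) - int (m + 3) * int (m + 2 choose Suc i))"
      by (simp add: F_def G_def coeff_gpoly coeff_narayana_shift algebra_simps del: binomial_Suc_Suc)
    also have "\<dots> = ?d * (int (m + 1) * (if i = 0 then 0 else int (m choose (i - 1)))
        - int (m + 1) * int (m choose i))"
      unfolding 1 2 3 4 by (simp add: algebra_simps)
    also have "\<dots> = coeff (smult (int (m + 1)) (xpoly * Q - E)) i"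
      by (cases i) (simp_all add: Q_def E_def coeff_xpoly_mult coeff_qpoly coeff_narayana_shift
        numeral_3_eq_3 algebra_simps del: binomial_Suc_Suc)
    finally show ?thesis .
  qed
qed

lemma P_Q: "smult (int (m + 3)) P = smult (int (m + 1)) (xpoly * (xpoly * Q))"
proof (rule poly_eqI)
  fix i
  consider "i = 0" | "i = 1" | j where "i = Suc (Suc j)" by (metis One_nat_def not0_implies_Suc)
  then show "coeff (smult (int (m + 3)) P) i = coeff (smult (int (m + 1)) (xpoly * (xpoly * Q))) i"
  proof cases
    case 3
    show ?thesis
    proof (cases "j \<le> Suc m")
      case False
      then show ?thesis
        by (simp add: 3 P_def Q_def coeff_xpoly_mult coeff_ppoly coeff_qpoly binomial_eq_0)
    next
      case True
      have 1: "int (m + 3) * int (m + 2 choose (j + 2)) = (int (m + 3) - int (j + 2)) * int (m + 3 choose (j + 2))"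
        using choose_absorb_comp[of "j + 2" "m + 2"] True
        by (simp add: numeral_3_eq_3 del: binomial_Suc_Suc)
      have 2: "int (m + 1) * int (m choose j) = (int (m + 1) - int j) * int (Suc m choose j)"
        using choose_absorb_comp[of j m] True by (simp del: binomial_Suc_Suc)
      have "coeff (smult (int (m + 3)) P) i =
          int (m + 3) * int (m + 2 choose (j + 2)) * int (Suc m choose j)"
        by (simp add: 3 P_def coeff_ppoly del: binomial_Suc_Suc)
      also have "\<dots> = (int (m + 1) * int (m choose j)) * int (m + 3 choose (j + 2))"
        unfolding 1 2 by simp
      also have "\<dots> = coeff (smult (int (m + 1)) (xpoly * (xpoly * Q))) i"
        by (simp add: 3 Q_def coeff_xpoly_mult coeff_qpoly numeral_3_eq_3 del: binomial_Suc_Suc)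
      finally show ?thesis .
    qed
  qed (simp_all add: P_def coeff_xpoly_mult coeff_ppoly)
qed

lemma H_E: "smult (int (m + 3)) H = smult (int (m + 1)) E"
proof (rule poly_eqI)
  fix i
  have 1: "int (m + 3) * int (m + 2 choose i) = int (Suc i) * int (m + 3 choose Suc i)"
    using choose_absorb[of i "m + 2"] by (simp add: numeral_3_eq_3 del: binomial_Suc_Suc)
  have 2: "int (m + 1) * int (m choose i) = int (Suc i) * int (Suc m choose Suc i)"
    using choose_absorb[of i m] by (simp del: binomial_Suc_Suc)
  have "coeff (smult (int (m + 3)) H) i = int (m + 3) * int (m + 2 choose i) * int (Suc m choose Suc i)"
    by (simp add: H_def coeff_narayana_shift del: binomial_Suc_Suc)
  also have "\<dots> = (int (m + 1) * int (m choose i)) * int (m + 3 choose Suc i)"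
    unfolding 1 2 by simp
  also have "\<dots> = coeff (smult (int (m + 1)) E) i"
    by (simp add: E_def coeff_narayana_shift del: binomial_Suc_Suc)
  finally show "coeff (smult (int (m + 3)) H) i = coeff (smult (int (m + 1)) E) i" .
qed

lemma reversal_identity: "F * F - P * Q = G * G - H * E"
proof -
  \<comment> \<open>Multiplied by \<open>m + 3\<close>, the difference of squares becomes
    \<open>m + 1\<close> times \<open>(x Q - E)(x Q + E)\<close>, that is
    \<open>x^2 Q^2 - E^2\<close>. This is also what \<open>P_Q\<close> and \<open>H_E\<close> give
    for \<open>P Q - H E\<close>.\<close>
  have "smult (int (m + 3)) ((F * F - G * G) - (P * Q - H * E)) =
      smult (int (m + 3)) (F - G) * (F + G) - (smult (int (m + 3)) P * Q - smult (int (m + 3)) H * E)"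
    by (simp add: algebra_simps smult_diff_right smult_add_right)
  also have "\<dots> = 0"
    unfolding F_plus_G F_minus_G P_Q H_E
    by (simp add: algebra_simps smult_diff_right smult_add_right)
  finally show ?thesis by (simp add: smult_eq_0_iff)
qed

lemma coeff_F_reverse: "coeff G i = (if i \<le> Suc m then coeff F (Suc m - i) else 0)"
  using binomial_symmetric[of i "Suc m"] binomial_symmetric[of "Suc i" "Suc (Suc m)"]
  by (simp add: F_def G_def coeff_gpoly coeff_narayana_shift binomial_eq_0 del: binomial_Suc_Suc)

lemma coeff_Q_reverse: "coeff E i = (if i \<le> m then coeff Q (m - i) else 0)"
  using binomial_symmetric[of i m] binomial_symmetric[of "Suc i" "m + 3"]
  by (simp add: Q_def E_def coeff_qpoly coeff_narayana_shift binomial_eq_0 numeral_3_eq_3 Suc_diff_le del: binomial_Suc_Suc)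

lemma coeff_P_reverse: "coeff H i = (if i \<le> Suc (Suc m) then coeff P (Suc (Suc m) - i) else 0)"
proof (cases "i \<le> m")
  case True
  then show ?thesis
    using binomial_symmetric[of i "m + 2"] binomial_symmetric[of "Suc i" "m + 1"]
    by (simp add: P_def H_def coeff_ppoly coeff_narayana_shift Suc_diff_le del: binomial_Suc_Suc)
next
  case False
  then show ?thesis
    by (auto simp: P_def H_def coeff_ppoly coeff_narayana_shift binomial_eq_0 simp del: binomial_Suc_Suc)
qed

text \<open>The formal degrees of \<open>F * F\<close> and of \<open>P * Q\<close> agree, as
  \<open>2 * (m + 1) = (m + 2) + m\<close>, so both products are reversed about the same
  centre.\<close>

lemma coeff_two_level_reverse:
  assumes "j \<le> 2 * Suc m"
  shows "coeff (F * F - P * Q) j = coeff (F * F - P * Q) (2 * Suc m - j)"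
proof -
  have "degree F \<le> Suc m" "degree P \<le> Suc (Suc m)" "degree Q \<le> m"
    by (intro degree_le allI impI, simp add: F_def P_def Q_def coeff_gpoly coeff_ppoly coeff_qpoly
      binomial_eq_0 del: binomial_Suc_Suc)+
  then have "coeff (G * G) j = coeff (F * F) (Suc m + Suc m - j)"
    "coeff (H * E) j = coeff (P * Q) (Suc (Suc m) + m - j)"
    using assms by (intro coeff_mult_reverse coeff_F_reverse coeff_P_reverse coeff_Q_reverse; simp)+
  then have "coeff (G * G - H * E) j = coeff (F * F - P * Q) (2 * Suc m - j)"
    by (simp add: mult_2)
  then show ?thesis unfolding reversal_identity .
qed

end

lemma palindromic_grid_2:
  assumes "r \<ge> 1"
  shows "palindromic (antichain_poly (grid 2 r (r + 1)))"
proof -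
  obtain m where r: "r = Suc m" using assms by (cases r) auto
  have "grid 2 r (r + 1) = two_level (0 + r) 0 0 (r + 1) (r + 1)"
    by (auto simp: chain_poset_def two_level_def)
  then have eq: "antichain_poly (grid 2 r (r + 1)) = two_level_poly r (r + 1) (r + 1)"
    by (simp only: antichain_poly_two_level[OF order_refl])
  show ?thesis
  proof (rule palindromic_antichain_polyI[OF finite_grid])
    show "degree (antichain_poly (grid 2 r (r + 1))) = 2 * r"
      using degree_grid_long[of 2 r "r + 1"] by simp
    show "coeff (antichain_poly (grid 2 r (r + 1))) j = coeff (antichain_poly (grid 2 r (r + 1))) (2 * r - j)"
      if "j \<le> 2 * r" for j
      using coeff_two_level_reverse[of j m] that
      unfolding eq two_level_poly_def unfolding r Suc_eq_plus1[symmetric] by blast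
  qed
qed

section \<open>Long grids\<close>

text \<open>The planes of ranks \<open>k + m + 1\<close> and \<open>k + m + 2\<close> both have the
  maximal size \<open>k * m\<close>; they differ above \<open>(1, 1)\<close>.\<close>

lemma grid_very_long:
  assumes "1 \<le> k" "1 \<le> m" "k + m \<le> n"
  shows "\<not> palindromic (antichain_poly (grid k m n))"
proof
  assume pal: "palindromic (antichain_poly (grid k m n))"
  let ?A = "\<lambda>s. graph_set (chain_poset k \<times> chain_poset m) (\<lambda>a b. s - a - b)"
  have anti: "?A (k + m + 1) \<in> antichains (grid k m n)" "?A (k + m + 2) \<in> antichains (grid k m n)"
    by (rule diagonal_antichain; use assms in simp)+
  have "?A (k + m + 2) = ?A (k + m + 1)"
    by (rule palindromic_unique_max[OF finite_grid pal anti(1) _ anti(2)])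
      (use grid_width in \<open>auto simp: card_diagonal_antichain\<close>)
  moreover have "(1, 1, k + m) \<in> ?A (k + m + 2)"
    unfolding in_graph_set using assms by (simp add: chain_poset_def)
  moreover have "(1, 1, k + m) \<notin> ?A (k + m + 1)"
    unfolding in_graph_set using assms by (simp add: chain_poset_def)
  ultimately show False by simp
qed

section \<open>The order-reversing involution of a grid\<close>

definition flip :: "nat \<Rightarrow> nat \<Rightarrow> nat \<Rightarrow> nat \<times> nat \<times> nat \<Rightarrow> nat \<times> nat \<times> nat" where
  "flip k m n = (\<lambda>(a, b, c). (k + 1 - a, m + 1 - b, n + 1 - c))"

lemma flip_flip: "x \<in> grid k m n \<Longrightarrow> flip k m n (flip k m n x) = x"
  by (cases x) (auto simp: flip_def chain_poset_def)

lemma flip_in_grid: "x \<in> grid k m n \<Longrightarrow> flip k m n x \<in> grid k m n"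
  by (cases x) (auto simp: flip_def chain_poset_def)

lemma inj_on_flip: "inj_on (flip k m n) (grid k m n)"
  by (rule inj_on_inverseI[of _ "flip k m n"]) (rule flip_flip)

lemma flip_le:
  "x \<in> grid k m n \<Longrightarrow> y \<in> grid k m n \<Longrightarrow> flip k m n x \<le> flip k m n y \<Longrightarrow> y \<le> x"
  by (cases x, cases y) (auto simp: flip_def chain_poset_def)

lemma flip_image_flip_image:
  assumes "A \<subseteq> grid k m n"
  shows "flip k m n ` flip k m n ` A = A"
proof -
  have "(\<lambda>x. flip k m n (flip k m n x)) ` A = (\<lambda>x. x) ` A"
    using assms by (intro image_cong refl flip_flip) blast
  then show ?thesis by (simp add: image_image)
qed

lemma flip_antichain:
  assumes "A \<in> antichains (grid k m n)"
  shows "flip k m n ` A \<in> antichains (grid k m n)"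
proof -
  have sub: "A \<subseteq> grid k m n" and eq: "\<And>x y. x \<in> A \<Longrightarrow> y \<in> A \<Longrightarrow> x \<le> y \<Longrightarrow> x = y"
    using assms by (auto simp: antichains_iff)
  show ?thesis
    unfolding antichains_iff
  proof (intro conjI ballI impI)
    show "flip k m n ` A \<subseteq> grid k m n"
      using sub flip_in_grid by blast
    fix x y assume "x \<in> flip k m n ` A" "y \<in> flip k m n ` A" "x \<le> y"
    then obtain x' y' where *: "x' \<in> A" "y' \<in> A" "x = flip k m n x'" "y = flip k m n y'" by auto
    then have "y' \<le> x'" using flip_le[of x' k m n y'] sub \<open>x \<le> y\<close> by blast
    then show "x = y" using * eq[of y' x'] by simp
  qed
qed

lemma card_flip_image:
  "A \<subseteq> grid k m n \<Longrightarrow> card (flip k m n ` A) = card A"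
  by (rule card_image) (rule inj_on_subset[OF inj_on_flip])

lemma choose_bound_3: "3 * (m + 3) * (m + 4) + 2 < 2 * (m + 6 choose 3)"
proof (induction m)
  case (Suc m)
  have "2 * (m + 6 choose 2) = (m + 6) * (m + 5)"
    using choose_two[of "m + 6"] by simp
  moreover have "(Suc m + 6 choose 3) = (m + 6 choose 3) + (m + 6 choose 2)"
    using binomial_Suc_Suc[of "m + 6" 2] by (simp only: add_Suc eval_nat_numeral)
  ultimately show ?case using Suc by (simp add: algebra_simps)
qed (simp add: numeral_3_eq_3 numeral_eq_Suc)

text \<open>Double induction by Pascal's rule from the boundary \<open>k = 3\<close> or
  \<open>m = 3\<close>, where the bound is a cubic estimate. It is nearly sharp at the start: for
  \<open>k = m = 3\<close> it reads \<open>38 < 40\<close>.\<close>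

lemma choose_bound:
  assumes "3 \<le> k" "3 \<le> m"
  shows "k * m * (k + m - 2) + 2 < 2 * (k + m choose k)"
proof -
  have "(k + 3) * (m + 3) * (k + m + 4) + 2 < 2 * (k + m + 6 choose (k + 3))" for k m :: nat
  proof (induction k arbitrary: m)
    case 0
    show ?case using choose_bound_3[of m] by (simp add: algebra_simps)
  next
    case (Suc k)
    note IHk = Suc.IH
    show ?case
    proof (induction m)
      case 0
      have "(Suc k + 6 choose 3) = (Suc k + 6 choose (Suc k + 3))"
        using binomial_symmetric[of 3 "Suc k + 6"] by simp
      then show ?case using choose_bound_3[of "Suc k"] by (simp add: algebra_simps)
    next
      case (Suc m)
      have "(Suc k + Suc m + 6 choose (Suc k + 3)) =
          (k + Suc m + 6 choose (k + 3)) + (Suc k + m + 6 choose (Suc k + 3))"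
        using binomial_Suc_Suc[of "k + Suc m + 6" "k + 3"] by (simp only: add_Suc add_Suc_right)
      then show ?case using IHk[of "Suc m"] Suc.IH
        by (simp add: algebra_simps)
    qed
  qed
  from this[of "k - 3" "m - 3"] show ?thesis using assms by simp
qed

text \<open>The antichain polynomial is evaluated at \<open>1\<close>, and the sum of products of
  binomials is Vandermonde's. The factor \<open>[1]\<close> only serves to stay within the type of
  triples.\<close>

lemma card_antichains_rectangle: "card (antichains (grid 1 k m)) = (k + m choose k)"
proof -
  have Q: "grid 1 k m = two_level (0 + k) 0 0 m 0"
    by (auto simp: chain_poset_def two_level_def)
  have "int (card (antichains (grid 1 k m))) = poly (antichain_poly (grid 1 k m)) 1"
    by (simp add: antichain_poly_def poly_sum poly_monom)
  also have "\<dots> = poly (gpoly k m) 1"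
    unfolding Q by (simp only: antichain_poly_two_level[OF le0]) (simp add: two_level_poly_def gpoly_0 qpoly_0)
  also have "\<dots> = int (\<Sum>i\<le>k. (m choose i) * (k choose (k - i)))"
    by (simp add: gpoly_def poly_sum poly_monom mult.commute binomial_symmetric[symmetric])
  also have "\<dots> = int (k + m choose k)"
    by (simp only: vandermonde[of m k k, symmetric] add.commute[of k m])
  finally show ?thesis by simp
qed

definition ideal_of :: "(nat \<times> nat \<times> nat) set \<Rightarrow> (nat \<times> nat) set" where
  "ideal_of B = {(a, b). \<exists>(l, a', b')\<in>B. a \<le> a' \<and> b \<le> b'}"

text \<open>An antichain consists of the maximal elements of the ideal that it generates. The
  comparison is confined to the rectangle because \<open>ideal_of\<close> also contains pairs with a
  coordinate \<open>0\<close>.\<close>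

lemma ideal_of_inj:
  assumes "B \<in> antichains (grid 1 k m)" "B' \<in> antichains (grid 1 k m)"
    and "\<And>a b. (a, b) \<in> chain_poset k \<times> chain_poset m \<Longrightarrow> (a, b) \<in> ideal_of B \<longleftrightarrow> (a, b) \<in> ideal_of B'"
  shows "B \<subseteq> B'"
proof
  fix x assume "x \<in> B"
  moreover obtain a b where x: "x = (1, a, b)" "(a, b) \<in> chain_poset k \<times> chain_poset m"
    using \<open>x \<in> B\<close> assms(1) by (auto simp: antichains_iff chain_poset_def)
  ultimately have "(a, b) \<in> ideal_of B" unfolding ideal_of_def by blast
  then obtain l c d where y: "(l, c, d) \<in> B'" "a \<le> c" "b \<le> d"
    using assms(3)[OF x(2)] unfolding ideal_of_def by blast
  then have l: "l = 1" and cd: "(c, d) \<in> chain_poset k \<times> chain_poset m"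
    using assms(2) by (auto simp: antichains_iff chain_poset_def)
  have "(c, d) \<in> ideal_of B'" using y(1) unfolding ideal_of_def by blast
  then obtain l' e f where z: "(l', e, f) \<in> B" "c \<le> e" "d \<le> f"
    using assms(3)[OF cd] unfolding ideal_of_def by blast
  then have "l' = 1" using assms(1) by (auto simp: antichains_iff chain_poset_def)
  then have "(1, e, f) \<in> B" "x \<le> (1, e, f)" using z y(2,3) x by auto
  then have "x = (1, e, f)"
    using assms(1) \<open>x \<in> B\<close> unfolding antichains_iff by blast
  then show "x \<in> B'" using x y z l by simp
qed

text \<open>Raising the points over \<open>U\<close> by one can only cause a collision between a
  lifted point and an unlifted one directly below it in the rectangle, which the last hypothesis
  forbids. The point over \<open>(1, 1)\<close> already has the top height \<open>k + m - 1\<close>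
  and must not be lifted.\<close>

lemma lifted_diagonal_antichain:
  assumes "D \<subseteq> chain_poset k \<times> chain_poset m" "U \<inter> D \<subseteq> D - {(1, 1)}"
    and "\<And>a b a' b'. (a, b) \<in> D \<Longrightarrow> (a', b') \<in> U \<Longrightarrow> a \<le> a' \<Longrightarrow> b \<le> b' \<Longrightarrow>
      (a, b) \<in> U \<or> a + b + 1 < a' + b'"
  shows "graph_set D (\<lambda>a b. k + m + 1 - a - b + of_bool ((a, b) \<in> U)) \<in> antichains (grid k m (k + m - 1))"
proof (rule graph_set_antichain[OF assms(1)])
  fix a b assume ab: "(a, b) \<in> D"
  then have r: "1 \<le> a" "a \<le> k" "1 \<le> b" "b \<le> m" using assms(1) by (auto simp: chain_poset_def)
  show "1 \<le> k + m + 1 - a - b + of_bool ((a, b) \<in> U) \<and>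
      k + m + 1 - a - b + of_bool ((a, b) \<in> U) \<le> k + m - 1"
  proof (cases "(a, b) \<in> U")
    case True
    then have "(a, b) \<noteq> (1, 1)" using assms(2) ab by blast
    then have "a + b \<ge> 3" using r by auto
    then show ?thesis using r True by simp
  next
    case False
    have "1 \<le> k + m + 1 - a - b \<and> k + m + 1 - a - b \<le> k + m - 1" using r by arith
    then show ?thesis using False by simp
  qed
  fix a' b' assume *: "(a', b') \<in> D" "a \<le> a'" "b \<le> b'" "(a, b) \<noteq> (a', b')"
  then have r': "a' \<le> k" "b' \<le> m" using assms(1) by (auto simp: chain_poset_def)
  have "a + b < a' + b'" using *(2-4) by auto
  then show "k + m + 1 - a' - b' + of_bool ((a', b') \<in> U) < k + m + 1 - a - b + of_bool ((a, b) \<in> U)"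
    using assms(3)[OF ab _ *(2,3)] r r' by (cases "(a', b') \<in> U") (auto simp: of_bool_def)
qed

lemma card_lifted_diagonal:
  assumes "p \<in> chain_poset k \<times> chain_poset m"
  shows "card (graph_set (chain_poset k \<times> chain_poset m - {p}) h) = k * m - 1"
  using assms by (simp add: card_graph_set card_Diff_singleton chain_poset_def card_cartesian_product)

text \<open>The order ideals of the rectangle, lifted by one step inside the middle level.\<close>

lemma card_lifted_ideals:
  assumes "1 \<le> k" "1 \<le> m" "k * m > 1"
  defines "S \<equiv> {A \<in> antichains (grid k m (k + m - 1)). card A = k * m - 1 \<and>
    (\<forall>c. (1, 1, c) \<notin> A) \<and> (\<exists>c. (k, m, c) \<in> A)}"
  shows "(k + m choose k) - 1 \<le> card S"
proof -
  let ?D = "chain_poset k \<times> chain_poset m - {(1, 1)}"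
  define f where "f B = graph_set ?D (\<lambda>a b. k + m + 1 - a - b + of_bool ((a, b) \<in> ideal_of B))" for B
  let ?B = "antichains (grid 1 k m) - {{}}"
  \<comment> \<open>Every nonempty ideal contains \<open>(1, 1)\<close>, so deleting this point
    loses no information. The empty ideal has to be left out, since it would give the same antichain
    as the ideal consisting of \<open>(1, 1)\<close>.\<close>
  have corner: "(1, 1) \<in> ideal_of B" if B: "B \<in> ?B" for B
  proof -
    obtain l a b where x: "(l, a, b) \<in> B" using B by auto
    moreover have "B \<subseteq> grid 1 k m" using B by (simp add: antichains_iff)
    ultimately have "1 \<le> a" "1 \<le> b" by (auto simp: chain_poset_def)
    then show ?thesis using x unfolding ideal_of_def by blast
  qed
  have sub: "f ` ?B \<subseteq> S"
  proof
    fix A assume "A \<in> f ` ?B"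
    then obtain B where A: "A = f B" and B: "B \<in> ?B" by blast
    have "A \<in> antichains (grid k m (k + m - 1))"
      unfolding A f_def
    proof (rule lifted_diagonal_antichain)
      fix a b a' b' assume "(a', b') \<in> ideal_of B" "a \<le> a'" "b \<le> b'"
      then show "(a, b) \<in> ideal_of B \<or> a + b + 1 < a' + b'"
        unfolding ideal_of_def by (auto intro: order_trans)
    qed auto
    moreover have "card A = k * m - 1"
      unfolding A f_def by (rule card_lifted_diagonal) (use assms in \<open>simp add: chain_poset_def\<close>)
    moreover have "(k, m) \<in> ?D" using assms by (auto simp: chain_poset_def)
    then have "\<exists>c. (k, m, c) \<in> A" unfolding A f_def in_graph_set by blast
    moreover have "\<forall>c. (1, 1, c) \<notin> A" unfolding A f_def in_graph_set by blast
    ultimately show "A \<in> S" unfolding S_def by blast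
  qed
  have "inj_on f ?B"
  proof (rule inj_onI)
    fix B B' assume B: "B \<in> ?B" "B' \<in> ?B" "f B = f B'"
    have "(a, b) \<in> ideal_of B \<longleftrightarrow> (a, b) \<in> ideal_of B'" if ab: "(a, b) \<in> chain_poset k \<times> chain_poset m" for a b
    proof (cases "(a, b) = (1, 1)")
      case True
      then show ?thesis using corner B(1,2) by simp
    next
      case False
      let ?c = "k + m + 1 - a - b"
      have "(a, b, ?c + of_bool ((a, b) \<in> ideal_of B)) \<in> f B"
        using False ab unfolding f_def in_graph_set by blast
      then have "(a, b, ?c + of_bool ((a, b) \<in> ideal_of B)) \<in> f B'" using B(3) by simp
      then have "?c + of_bool ((a, b) \<in> ideal_of B) = ?c + of_bool ((a, b) \<in> ideal_of B')"
        unfolding f_def in_graph_set by blast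
      then show ?thesis by (simp add: of_bool_def split: if_splits)
    qed
    then show "B = B'"
      using ideal_of_inj[of B k m B'] ideal_of_inj[of B' k m B] B(1,2) by (intro equalityI) blast+
  qed
  then have "card ?B = card (f ` ?B)" by (simp add: card_image)
  also have "\<dots> \<le> card S"
    by (rule card_mono[OF _ sub]) (simp add: S_def finite_antichains finite_grid)
  also have "card ?B = (k + m choose k) - 1"
    using finite_antichains[OF finite_grid, of 1 k m]
    by (subst card_Diff_singleton) (auto simp: antichains_iff card_antichains_rectangle[symmetric])
  finally show ?thesis .
qed

text \<open>The map \<open>flip\<close> exchanges the columns over \<open>(1, 1)\<close> and
  \<open>(k, m)\<close>.\<close>

lemma card_flipped_lifted_ideals:
  assumes "1 \<le> k" "1 \<le> m" "k * m > 1"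
  shows "card {A \<in> antichains (grid k m n). card A = d \<and> (\<forall>c. (1, 1, c) \<notin> A) \<and> (\<exists>c. (k, m, c) \<in> A)}
    \<le> card {A \<in> antichains (grid k m n). card A = d \<and> (\<exists>c. (1, 1, c) \<in> A) \<and> (\<forall>c. (k, m, c) \<notin> A)}"
    (is "card ?S \<le> card ?T")
proof (rule card_inj_on_le)
  have sub: "A \<subseteq> grid k m n" if "A \<in> ?S" for A using that by (simp add: antichains_iff)
  show "inj_on (image (flip k m n)) ?S"
    by (rule inj_on_inverseI[of _ "image (flip k m n)"]) (rule flip_image_flip_image[OF sub])
  show "image (flip k m n) ` ?S \<subseteq> ?T"
  proof (clarify, intro conjI)
    fix A c assume A: "A \<in> antichains (grid k m n)" and no: "\<forall>c. (1, 1, c) \<notin> A" and c: "(k, m, c) \<in> A"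
    then have s: "A \<subseteq> grid k m n" by (simp add: antichains_iff)
    show "flip k m n ` A \<in> antichains (grid k m n)" using A by (rule flip_antichain)
    show "card (flip k m n ` A) = card A" using s by (rule card_flip_image)
    have "flip k m n (k, m, c) = (1, 1, n + 1 - c)" by (simp add: flip_def)
    then show "\<exists>c. (1, 1, c) \<in> flip k m n ` A" using c by (metis imageI)
    show "\<forall>c. (k, m, c) \<notin> flip k m n ` A"
    proof (intro allI notI)
      fix c assume "(k, m, c) \<in> flip k m n ` A"
      then obtain x where x: "x \<in> A" "flip k m n x = (k, m, c)" by auto
      then have "x = flip k m n (k, m, c)" using flip_flip s by (metis subsetD)
      then have "x = (1, 1, n + 1 - c)" by (simp add: flip_def)
      then show False using x(1) no by simp
    qed
  qed
  show "finite ?T" by (simp add: finite_antichains finite_grid)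
qed

lemma card_near_diagonal:
  assumes "3 \<le> k" "3 \<le> m"
  defines "S \<equiv> {A \<in> antichains (grid k m (k + m - 1)). card A = k * m - 1 \<and>
    (\<exists>c. (1, 1, c) \<in> A) \<and> (\<exists>c. (k, m, c) \<in> A)}"
  shows "k * m \<le> card S"
proof -
  let ?R = "chain_poset k \<times> chain_poset m"
  define g where "g p U = graph_set (?R - {p}) (\<lambda>a b. k + m + 1 - a - b + of_bool ((a, b) \<in> U))" for p U
  have g: "g p U \<in> S"
    if "p \<in> ?R - {(1, 1), (k, m)}" "(1, 1) \<notin> U"
      "\<And>a b a' b'. (a, b) \<in> ?R - {p} \<Longrightarrow> (a', b') \<in> U \<Longrightarrow> a \<le> a' \<Longrightarrow> b \<le> b' \<Longrightarrow>
        (a, b) \<in> U \<or> a + b + 1 < a' + b'" for p U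
  proof -
    have "g p U \<in> antichains (grid k m (k + m - 1))"
      unfolding g_def by (rule lifted_diagonal_antichain[OF _ _ that(3)]) (use that(1,2) in auto)
    moreover have "card (g p U) = k * m - 1"
      unfolding g_def by (rule card_lifted_diagonal) (use that(1) in blast)
    moreover have "(1, 1) \<in> ?R - {p}" "(k, m) \<in> ?R - {p}"
      using that(1) assms(1,2) by (auto simp: chain_poset_def)
    then have "\<exists>c. (1, 1, c) \<in> g p U" "\<exists>c. (k, m, c) \<in> g p U"
      unfolding g_def in_graph_set by blast+
    ultimately show ?thesis unfolding S_def by blast
  qed
  let ?P = "(\<lambda>p. g p {}) ` (?R - {(1, 1), (k, m)})"
  \<comment> \<open>Besides the middle level with one non-corner point removed, which gives
    \<open>k * m - 2\<close> sets, two more are needed. Once \<open>(1, m - 1)\<close> is gone, no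
    remaining point lies directly below \<open>(1, m)\<close>, which can thus be lifted; likewise
    for \<open>(k, 1)\<close>.\<close>
  let ?E = "g (1, m - 1) {(1, m)}" and ?F = "g (k - 1, 1) {(k, 1)}"
  have E: "?E \<in> S"
    by (rule g) (use assms(1,2) in \<open>auto simp: chain_poset_def\<close>)
  have F: "?F \<in> S"
    by (rule g) (use assms(1,2) in \<open>auto simp: chain_poset_def\<close>)
  have P: "?P \<subseteq> S" using g[of _ "{}"] by blast
  have inE: "(1, m, k + 1) \<in> ?E" and inF: "(k, 1, m + 1) \<in> ?F"
    using assms(1,2) by (auto simp: g_def in_graph_set chain_poset_def)
  have "(1, m, k + 1) \<notin> g p {}" "(k, 1, m + 1) \<notin> g p {}" for p
    by (auto simp: g_def in_graph_set)
  then have EP: "?E \<notin> ?P" and FP: "?F \<notin> ?P" using inE inF by auto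
  have "(1, m, k + 1) \<notin> ?F" using assms(1,2) by (auto simp: g_def in_graph_set)
  then have EF: "?E \<noteq> ?F" using inE by metis
  have "inj_on (\<lambda>p. g p {}) (?R - {(1, 1), (k, m)})"
  proof (rule inj_onI)
    fix p q assume p: "p \<in> ?R - {(1, 1), (k, m)}" and q: "q \<in> ?R - {(1, 1), (k, m)}" and eq: "g p {} = g q {}"
    obtain a b where ab: "p = (a, b)" by (cases p)
    have "(a, b, k + m + 1 - a - b) \<notin> g p {}" by (simp add: g_def in_graph_set ab)
    then have "(a, b, k + m + 1 - a - b) \<notin> g q {}" using eq by simp
    then show "p = q" using p by (simp add: g_def in_graph_set ab)
  qed
  then have "card ?P = card (?R - {(1, 1), (k, m)})" by (rule card_image)
  also have "\<dots> = k * m - 2"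
    using assms(1,2) by (subst card_Diff_subset) (auto simp: chain_poset_def card_cartesian_product)
  finally have "card (insert ?E (insert ?F ?P)) = k * m"
    using EP FP EF mult_le_mono[OF assms(1,2)] by (simp add: chain_poset_def)
  moreover have "card (insert ?E (insert ?F ?P)) \<le> card S"
    by (rule card_mono) (use E F P in \<open>auto simp: S_def finite_antichains finite_grid\<close>)
  ultimately show ?thesis by simp
qed

text \<open>The families \<open>?S1\<close>, \<open>?S2\<close> and \<open>?S3\<close> are disjoint,
  being told apart by which of the two corner columns they use. Together they have at least
  \<open>2 * ((k + m choose k) - 1) + k * m\<close> members, which exceeds
  \<open>k * m * (k + m - 1)\<close> by \<open>choose_bound\<close>.\<close>

lemma grid_long:
  assumes "3 \<le> k" "3 \<le> m"
  shows "\<not> palindromic (antichain_poly (grid k m (k + m - 1)))"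
proof
  assume pal: "palindromic (antichain_poly (grid k m (k + m - 1)))"
  let ?Q = "grid k m (k + m - 1)"
  let ?A = "graph_set (chain_poset k \<times> chain_poset m) (\<lambda>a b. (k + m + 1) - a - b)"
  let ?S = "{A \<in> antichains ?Q. card A = k * m - 1}"
  let ?S1 = "{A \<in> antichains ?Q. card A = k * m - 1 \<and> (\<forall>c. (1, 1, c) \<notin> A) \<and> (\<exists>c. (k, m, c) \<in> A)}"
  let ?S2 = "{A \<in> antichains ?Q. card A = k * m - 1 \<and> (\<exists>c. (1, 1, c) \<in> A) \<and> (\<forall>c. (k, m, c) \<notin> A)}"
  let ?S3 = "{A \<in> antichains ?Q. card A = k * m - 1 \<and> (\<exists>c. (1, 1, c) \<in> A) \<and> (\<exists>c. (k, m, c) \<in> A)}"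
  have A: "?A \<in> antichains ?Q" by (rule diagonal_antichain) (use assms in auto)
  have max: "\<forall>B\<in>antichains ?Q. card B \<le> card ?A"
    using grid_width by (simp add: card_diagonal_antichain)
  have km: "9 \<le> k * m" using mult_le_mono[OF assms] by simp
  have "1 \<le> card ?A" using assms by (simp add: card_diagonal_antichain)
  from palindromic_second_coeff[OF finite_grid pal A max this]
  have card_S: "card ?S = k * m * (k + m - 1)"
    by (simp only: card_diagonal_antichain card_grid)
  have fin: "finite (antichains ?Q)" by (rule finite_antichains[OF finite_grid])
  have "card ?S1 + card ?S2 + card ?S3 = card (?S1 \<union> ?S2 \<union> ?S3)"
    using fin by (subst card_Un_disjoint, auto)+
  also have "\<dots> \<le> card ?S"
    by (rule card_mono) (use fin in auto)
  finally have "card ?S1 + card ?S2 + card ?S3 \<le> k * m * (k + m - 1)" using card_S by simp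
  moreover have "(k + m choose k) - 1 \<le> card ?S1"
    by (rule card_lifted_ideals) (use assms km in auto)
  moreover have "card ?S1 \<le> card ?S2"
    by (rule card_flipped_lifted_ideals) (use assms km in auto)
  moreover have "k * m \<le> card ?S3" by (rule card_near_diagonal[OF assms])
  ultimately have "2 * ((k + m choose k) - 1) + k * m \<le> k * m * (k + m - 1)" by linarith
  moreover have "k * m * (k + m - 1) = k * m * (k + m - 2) + k * m"
  proof -
    have "k + m - 1 = (k + m - 2) + 1" using assms by simp
    then show ?thesis by (simp only: distrib_left mult_1_right)
  qed
  ultimately show False using choose_bound[OF assms] by simp
qed

section \<open>Shadows in level sets\<close>

definition rk :: "nat \<times> nat \<times> nat \<Rightarrow> nat" where
  "rk = (\<lambda>(a, b, c). a + b + c)"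

lemma rk_simp [simp]: "rk (a, b, c) = a + b + c"
  by (simp add: rk_def)

lemma rk_le_eq: "x \<le> y \<Longrightarrow> rk y \<le> rk x \<Longrightarrow> x = y"
  by (cases x, cases y) auto

definition level :: "nat \<Rightarrow> nat \<Rightarrow> nat \<Rightarrow> nat \<Rightarrow> (nat \<times> nat \<times> nat) set" where
  "level k m n s = {x \<in> grid k m n. rk x = s}"

lemma in_level:
  "(a, b, c) \<in> level k m n s \<longleftrightarrow>
    1 \<le> a \<and> a \<le> k \<and> 1 \<le> b \<and> b \<le> m \<and> 1 \<le> c \<and> c \<le> n \<and> a + b + c = s"
  unfolding level_def mem_Collect_eq in_grid by auto

lemma finite_level: "finite (level k m n s)"
  by (simp add: level_def finite_grid)

lemma level_antichain: "level k m n s \<in> antichains (grid k m n)"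
  unfolding antichains_iff level_def using rk_le_eq by fastforce

text \<open>Only the lower bounds of the grid are imposed here; the upper ones are inherited from
  \<open>X\<close>.\<close>

definition lower_shadow :: "(nat \<times> nat \<times> nat) set \<Rightarrow> (nat \<times> nat \<times> nat) set" where
  "lower_shadow X = {(a, b, c). 1 \<le> a \<and> 1 \<le> b \<and> 1 \<le> c \<and>
     ((a + 1, b, c) \<in> X \<or> (a, b + 1, c) \<in> X \<or> (a, b, c + 1) \<in> X)}"

lemma in_lower_shadow:
  "(a, b, c) \<in> lower_shadow X \<longleftrightarrow> 1 \<le> a \<and> 1 \<le> b \<and> 1 \<le> c \<and>
     ((a + 1, b, c) \<in> X \<or> (a, b + 1, c) \<in> X \<or> (a, b, c + 1) \<in> X)"
  by (simp add: lower_shadow_def)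

lemma lower_shadowE:
  assumes "z \<in> lower_shadow X"
  obtains x where "x \<in> X" "z \<le> x" "rk x = rk z + 1"
proof -
  obtain a b c where z: "z = (a, b, c)" by (cases z)
  have "(a + 1, b, c) \<in> X \<or> (a, b + 1, c) \<in> X \<or> (a, b, c + 1) \<in> X"
    using assms unfolding z in_lower_shadow by blast
  then show thesis
  proof (elim disjE)
    assume "(a + 1, b, c) \<in> X"
    then show thesis by (rule that) (simp_all add: z)
  next
    assume "(a, b + 1, c) \<in> X"
    then show thesis by (rule that) (simp_all add: z)
  next
    assume "(a, b, c + 1) \<in> X"
    then show thesis by (rule that) (simp_all add: z)
  qed
qed

lemma lower_shadow_level:
  assumes "X \<subseteq> level k m n (s + 1)"
  shows "lower_shadow X \<subseteq> level k m n s"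
proof
  fix z assume z: "z \<in> lower_shadow X"
  obtain a b c where abc: "z = (a, b, c)" by (cases z)
  have "1 \<le> a" "1 \<le> b" "1 \<le> c"
    and "(a + 1, b, c) \<in> X \<or> (a, b + 1, c) \<in> X \<or> (a, b, c + 1) \<in> X"
    using z unfolding abc in_lower_shadow by auto
  then have "(a + 1, b, c) \<in> level k m n (s + 1) \<or> (a, b + 1, c) \<in> level k m n (s + 1) \<or>
      (a, b, c + 1) \<in> level k m n (s + 1)"
    using assms by blast
  then show "z \<in> level k m n s"
    unfolding abc in_level using \<open>1 \<le> a\<close> \<open>1 \<le> b\<close> \<open>1 \<le> c\<close> by auto
qed

lemma finite_subset_level: "X \<subseteq> level k m n s \<Longrightarrow> finite X"
  using finite_level by (rule rev_finite_subset)

lemma finite_lower_shadow: "X \<subseteq> level k m n (s + 1) \<Longrightarrow> finite (lower_shadow X)"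
  by (rule finite_subset_level[OF lower_shadow_level])

abbreviation third :: "nat \<times> nat \<times> nat \<Rightarrow> nat" where "third x \<equiv> snd (snd x)"

lemma level_eqI:
  assumes "x \<in> level k m n s" "y \<in> level k m n s"
    and "third x = third y" "fst x = fst y \<or> fst (snd x) = fst (snd y)"
  shows "x = y"
proof -
  have "fst z + fst (snd z) + third z = s" if "z \<in> level k m n s" for z
    using that by (cases z) (simp add: level_def)
  from this[OF assms(1)] this[OF assms(2)] show ?thesis
    using assms(3,4) by (cases x; cases y) auto
qed

text \<open>In each row (fixed third coordinate) the shadow contains a copy of the row, shifted along the second
  coordinate, and one more point next to the end of the row; these only fail to exist
  on the faces where the second or the first coordinate is \<open>1\<close>.\<close>

lemma row_shadow:
  assumes X: "X \<subseteq> level k m n (s + 1)"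
  obtains U where "U \<subseteq> lower_shadow X"
    and "card X + card (third ` X) = card U + card {x \<in> X. fst x = 1} + card {x \<in> X. fst (snd x) = 1}"
    and "\<forall>a b c. (a, b, c) \<in> U \<longrightarrow> c \<in> third ` X \<and>
      ((a, b + 1, c) \<in> X \<or> (a + 1, b, c) \<in> X \<and> (\<forall>a' b'. (a', b', c) \<in> X \<longrightarrow> a < a'))"
proof -
  let ?A = "{x \<in> X. fst x = 1}" and ?B = "{x \<in> X. fst (snd x) = 1}" and ?T = "third ` X"
  have fin: "finite X" by (rule finite_subset_level[OF X])
  have lev: "1 \<le> a \<and> 1 \<le> b \<and> 1 \<le> c \<and> a + b + c = s + 1" if "(a, b, c) \<in> X" for a b c
    using subsetD[OF X that] unfolding in_level by simp
  \<comment> \<open>The point \<open>(r c, y c, c)\<close> is the end of row \<open>c\<close> with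
    the smallest first coordinate.\<close>
  define r where "r c = (LEAST a. \<exists>b. (a, b, c) \<in> X)" for c
  define y where "y c = s + 1 - r c - c" for c
  have r: "(r c, y c, c) \<in> X" and r_le: "\<And>a b. (a, b, c) \<in> X \<Longrightarrow> r c \<le> a" if c: "c \<in> ?T" for c
  proof -
    obtain x where x: "x \<in> X" "c = third x" using c by blast
    then have "(fst x, fst (snd x), c) \<in> X" by simp
    then have "\<exists>b. (r c, b, c) \<in> X" unfolding r_def by (intro LeastI_ex[where P = "\<lambda>a. \<exists>b. (a, b, c) \<in> X"]) blast
    then obtain b' where b': "(r c, b', c) \<in> X" by blast
    moreover have "b' = y c" using lev[OF b'] unfolding y_def by auto
    ultimately show "(r c, y c, c) \<in> X" by simp
    show "r c \<le> a" if "(a, b, c) \<in> X" for a b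
      unfolding r_def by (rule Least_le[where P = "\<lambda>a. \<exists>b. (a, b, c) \<in> X"]) (use that in blast)
  qed
  let ?f = "\<lambda>(a, b, c). (a, b - 1, c)" and ?g = "\<lambda>c. (r c - 1, y c, c)"
  let ?T' = "{c \<in> ?T. r c \<noteq> 1}"
  \<comment> \<open>\<open>F\<close> consists of the rows moved down in the second coordinate, and
    \<open>G\<close> has one point for each row, obtained from its end by lowering the first
    coordinate.\<close>
  define F where "F = ?f ` (X - ?B)"
  define G where "G = ?g ` ?T'"
  have inF: "(a, b, c) \<in> F \<longleftrightarrow> 1 \<le> b \<and> (a, b + 1, c) \<in> X" for a b c
  proof
    assume "(a, b, c) \<in> F"
    then obtain x where x: "x \<in> X - ?B" "(a, b, c) = ?f x" unfolding F_def by (rule imageE)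
    obtain a' b' c' where x': "x = (a', b', c')" by (cases x)
    have "(a, b', c) \<in> X" "b' \<noteq> 1" "b = b' - 1" using x unfolding x' by auto
    then show "1 \<le> b \<and> (a, b + 1, c) \<in> X" using lev[of a b' c] by auto
  next
    assume *: "1 \<le> b \<and> (a, b + 1, c) \<in> X"
    then have "(a, b + 1, c) \<in> X - ?B" by auto
    then have "?f (a, b + 1, c) \<in> F" unfolding F_def by blast
    then show "(a, b, c) \<in> F" by simp
  qed
  have inG: "1 \<le> a \<and> 1 \<le> b \<and> (a + 1, b, c) \<in> X \<and> c \<in> ?T \<and> a < r c" if G: "(a, b, c) \<in> G" for a b c
  proof -
    have *: "c \<in> ?T" "r c \<noteq> 1" "a = r c - 1" "b = y c" using G unfolding G_def by auto
    have "1 \<le> r c" "1 \<le> y c" using lev[OF r[OF *(1)]] by auto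
    then have "a + 1 = r c" "1 \<le> a" using *(2,3) by auto
    then show ?thesis using * r[OF *(1)] \<open>1 \<le> y c\<close> by auto
  qed
  have "inj_on ?f (X - ?B)"
  proof (rule inj_onI)
    fix x x' assume *: "x \<in> X - ?B" "x' \<in> X - ?B" "?f x = ?f x'"
    obtain a b c where x: "x = (a, b, c)" by (cases x)
    obtain a' b' c' where x': "x' = (a', b', c')" by (cases x')
    show "x = x'" using * lev[of a b c] lev[of a' b' c'] unfolding x x' by auto
  qed
  then have "card F = card (X - ?B)" unfolding F_def by (rule card_image)
  also have "\<dots> = card X - card ?B" using fin by (intro card_Diff_subset) auto
  finally have cF: "card F + card ?B = card X"
    using card_mono[OF fin, of ?B] by auto
  have "card G = card ?T'"
    unfolding G_def by (rule card_image) (simp add: inj_on_def)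
  \<comment> \<open>The rows without a point in \<open>G\<close> are those reaching the face
    \<open>a = 1\<close>, and each of them meets this face in exactly one point.\<close>
  moreover have "card ?A = card {c \<in> ?T. r c = 1}"
  proof (rule bij_betw_same_card[of third])
    show "bij_betw third ?A {c \<in> ?T. r c = 1}"
      unfolding bij_betw_def
    proof (intro conjI equalityI subsetI)
      show "inj_on third ?A"
      proof (rule inj_onI)
        fix x x' assume *: "x \<in> ?A" "x' \<in> ?A" "third x = third x'"
        show "x = x'"
          by (rule level_eqI[of x k m n "s + 1"]) (use * X in auto)
      qed
      fix c assume "c \<in> third ` ?A"
      then obtain b where b: "(1, b, c) \<in> X" by auto
      then have c: "c \<in> ?T" by force
      then show "c \<in> {c \<in> ?T. r c = 1}" using r_le[OF c b] lev[OF r[OF c]] by auto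
    next
      fix c assume c: "c \<in> {c \<in> ?T. r c = 1}"
      then have "(1, y c, c) \<in> ?A" using r[of c] by auto
      then show "c \<in> third ` ?A" by force
    qed
  qed
  moreover have "card ?T = card ?T' + card {c \<in> ?T. r c = 1}"
    using fin by (subst card_Un_disjoint[symmetric]) (auto intro: arg_cong[where f = card])
  ultimately have cG: "card G + card ?A = card ?T" by simp
  have "F \<inter> G = {}"
  proof (rule equals0I)
    fix x assume x: "x \<in> F \<inter> G"
    obtain a b c where abc: "x = (a, b, c)" by (cases x)
    have "(a, b + 1, c) \<in> X" "c \<in> ?T" "a < r c" using x inF inG unfolding abc by auto
    then show False using r_le[of c a] by force
  qed
  moreover have "finite F" "finite G" unfolding F_def G_def using fin by auto
  ultimately have "card (F \<union> G) = card F + card G" by (intro card_Un_disjoint)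
  show thesis
  proof (rule that)
    show "F \<union> G \<subseteq> lower_shadow X"
    proof
      fix x assume x: "x \<in> F \<union> G"
      obtain a b c where abc: "x = (a, b, c)" by (cases x)
      have "x \<in> F \<Longrightarrow> x \<in> lower_shadow X"
        using lev[of a "b + 1" c] unfolding abc inF in_lower_shadow by auto
      moreover have "x \<in> G \<Longrightarrow> x \<in> lower_shadow X"
        using lev[of "a + 1" b c] inG[of a b c] unfolding abc in_lower_shadow by blast
      ultimately show "x \<in> lower_shadow X" using x by blast
    qed
    show "card X + card ?T = card (F \<union> G) + card ?A + card ?B"
      using cF cG \<open>card (F \<union> G) = card F + card G\<close> by simp
    show "\<forall>a b c. (a, b, c) \<in> F \<union> G \<longrightarrow> c \<in> ?T \<and>
      ((a, b + 1, c) \<in> X \<or> (a + 1, b, c) \<in> X \<and> (\<forall>a' b'. (a', b', c) \<in> X \<longrightarrow> a < a'))"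
    proof (intro allI impI, elim UnE)
      fix a b c
      assume "(a, b, c) \<in> F"
      then have "(a, b + 1, c) \<in> X" using inF by blast
      then show "c \<in> ?T \<and> ((a, b + 1, c) \<in> X \<or> (a + 1, b, c) \<in> X \<and> (\<forall>a' b'. (a', b', c) \<in> X \<longrightarrow> a < a'))"
        by force
    next
      fix a b c
      assume "(a, b, c) \<in> G"
      then show "c \<in> ?T \<and> ((a, b + 1, c) \<in> X \<or> (a + 1, b, c) \<in> X \<and> (\<forall>a' b'. (a', b', c) \<in> X \<longrightarrow> a < a'))"
        using inG[of a b c] r_le[of c] by (meson order_less_le_trans)
    qed
  qed
qed

text \<open>On the level \<open>s + 1\<close> a point with first coordinate \<open>1\<close> has
  second coordinate \<open>s - c\<close>, which must be at most \<open>m\<close>; similarly for the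
  other face. Hence each row meets each face at most once, and only if \<open>c\<close> is
  large.\<close>

lemma card_first_face:
  assumes X: "X \<subseteq> level k m n (s + 1)"
  shows "card {x \<in> X. fst x = 1} \<le> card {c \<in> third ` X. s \<le> m + c}"
    and "card {x \<in> X. fst (snd x) = 1} \<le> card {c \<in> third ` X. s \<le> k + c}"
    and "third ` {x \<in> X. fst x = 1} \<subseteq> {c \<in> third ` X. s \<le> m + c}"
    and "third ` {x \<in> X. fst (snd x) = 1} \<subseteq> {c \<in> third ` X. s \<le> k + c}"
    and "card {x \<in> X. fst x = 1} = card (third ` {x \<in> X. fst x = 1})"
    and "card {x \<in> X. fst (snd x) = 1} = card (third ` {x \<in> X. fst (snd x) = 1})"
proof -
  have fin: "finite X" by (rule finite_subset_level[OF X])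
  have lev: "a \<le> k \<and> b \<le> m \<and> a + b + c = s + 1" if "(a, b, c) \<in> X" for a b c
    using subsetD[OF X that] unfolding in_level by simp
  have "inj_on third {x \<in> X. fst x = 1}"
    by (rule inj_onI, rule level_eqI[of _ k m n "s + 1"]) (use X in auto)
  moreover have "inj_on third {x \<in> X. fst (snd x) = 1}"
    by (rule inj_onI, rule level_eqI[of _ k m n "s + 1"]) (use X in auto)
  ultimately show 5: "card {x \<in> X. fst x = 1} = card (third ` {x \<in> X. fst x = 1})"
    and 6: "card {x \<in> X. fst (snd x) = 1} = card (third ` {x \<in> X. fst (snd x) = 1})"
    by (simp_all add: card_image)
  have "s \<le> m + third x" if "x \<in> X" "fst x = 1" for x
    using that lev by (cases x) fastforce
  then show 3: "third ` {x \<in> X. fst x = 1} \<subseteq> {c \<in> third ` X. s \<le> m + c}" by blast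
  have "s \<le> k + third x" if "x \<in> X" "fst (snd x) = 1" for x
    using that lev by (cases x) fastforce
  then show 4: "third ` {x \<in> X. fst (snd x) = 1} \<subseteq> {c \<in> third ` X. s \<le> k + c}" by blast
  show "card {x \<in> X. fst x = 1} \<le> card {c \<in> third ` X. s \<le> m + c}"
    unfolding 5 using fin 3 by (intro card_mono) auto
  show "card {x \<in> X. fst (snd x) = 1} \<le> card {c \<in> third ` X. s \<le> k + c}"
    unfolding 6 using fin 4 by (intro card_mono) auto
qed

text \<open>The part \<open>X1\<close> is the initial run of occupied rows and row
  \<open>t + 1\<close> is empty. The shadow of \<open>X1\<close> lies in rows up to \<open>t\<close>
  and that of \<open>X2\<close> in rows from \<open>t + 1\<close> on, so the two are
  disjoint.\<close>

lemma consecutive_rows: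
  assumes X: "X \<subseteq> level k m n (s + 1)" and "(a0, b0, 1) \<in> X"
  obtains t X1 X2 where "1 \<le> t" "t \<le> n" "X = X1 \<union> X2" "X1 \<inter> X2 = {}" "X1 \<noteq> {}" "third ` X1 = {1..t}"
    "card (lower_shadow X) = card (lower_shadow X1) + card (lower_shadow X2)"
proof -
  let ?T = "third ` X"
  have fin: "finite X" by (rule finite_subset_level[OF X])
  have T: "?T \<subseteq> {1..n}" using X in_level by force
  have "n + 1 \<notin> ?T" using T by auto
  define t where "t = (LEAST t. t + 1 \<notin> ?T)"
  have t: "t + 1 \<notin> ?T" unfolding t_def by (rule LeastI[where P = "\<lambda>t. t + 1 \<notin> ?T"]) fact
  have below: "c \<in> ?T" if "1 \<le> c" "c \<le> t" for c
  proof -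
    have "\<not> (c - 1) + 1 \<notin> ?T" by (rule not_less_Least) (use that t_def in simp)
    then show ?thesis using that by simp
  qed
  have "1 \<in> ?T" using assms(2) by force
  then have "t \<noteq> 0" using t by (metis add_0)
  then have "1 \<le> t" by simp
  then have "t \<le> n" using below[of t] T by auto
  let ?X1 = "{x \<in> X. third x \<le> t}" and ?X2 = "{x \<in> X. t < third x}"
  have X2: "t + 2 \<le> third x" if "x \<in> ?X2" for x
  proof -
    have "third x \<noteq> t + 1" using t that by force
    then show ?thesis using that by auto
  qed
  have un: "lower_shadow X = lower_shadow ?X1 \<union> lower_shadow ?X2"
    unfolding lower_shadow_def by auto
  have "lower_shadow ?X1 \<inter> lower_shadow ?X2 = {}"
  proof (rule equals0I)
    fix z assume z: "z \<in> lower_shadow ?X1 \<inter> lower_shadow ?X2"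
    obtain a b c where abc: "z = (a, b, c)" by (cases z)
    have "c \<le> t" using z unfolding abc Int_iff in_lower_shadow by auto
    moreover have "(a + 1, b, c) \<in> ?X2 \<or> (a, b + 1, c) \<in> ?X2 \<or> (a, b, c + 1) \<in> ?X2"
      using z unfolding abc Int_iff in_lower_shadow by blast
    then have "t + 2 \<le> c + 1" using X2 by fastforce
    ultimately show False by simp
  qed
  moreover have "finite (lower_shadow ?X1)" "finite (lower_shadow ?X2)"
    using X by (auto intro!: finite_lower_shadow[of _ k m n s])
  ultimately have cs: "card (lower_shadow X) = card (lower_shadow ?X1) + card (lower_shadow ?X2)"
    unfolding un by (simp add: card_Un_disjoint)
  have im: "third ` ?X1 = {1..t}"
  proof (intro equalityI subsetI)
    fix c assume "c \<in> third ` ?X1"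
    then show "c \<in> {1..t}" using T by auto
  next
    fix c assume "c \<in> {1..t}"
    then have "c \<in> ?T" "c \<le> t" using below by auto
    then show "c \<in> third ` ?X1" by auto
  qed
  show thesis
  proof (rule that[OF \<open>1 \<le> t\<close> \<open>t \<le> n\<close> _ _ _ im cs])
    show "?X1 \<noteq> {}" using im \<open>1 \<le> t\<close> by force
  qed auto
qed

text \<open>The outer truncated subtractions are intended: they give \<open>0\<close> when the run
  ends before the rows that can reach the face.\<close>

lemma face_bounds:
  assumes X: "X \<subseteq> level k m n (s + 1)" and T: "third ` X = {1..t}" and "m + 2 \<le> s" "k + 2 \<le> s"
  shows "card {x \<in> X. fst x = 1} \<le> t - (s - m - 1)" "card {x \<in> X. fst (snd x) = 1} \<le> t - (s - k - 1)"
proof -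
  have "{c \<in> {1..t}. s \<le> m + c} = {s - m..t}" "{c \<in> {1..t}. s \<le> k + c} = {s - k..t}"
    using assms(3,4) by auto
  then show "card {x \<in> X. fst x = 1} \<le> t - (s - m - 1)" "card {x \<in> X. fst (snd x) = 1} \<le> t - (s - k - 1)"
    using card_first_face(1,2)[OF X] assms(3,4) unfolding T by auto
qed

text \<open>The run \<open>X1\<close> gains one point for each of its \<open>t\<close> rows and
  loses at most the two face counts. As \<open>t \<le> n\<close>, the rank condition makes the
  balance nonnegative, or positive in the stricter case, while \<open>X2\<close> does not shrink by
  induction.\<close>

lemma shadow_grows_touching:
  assumes X: "X \<subseteq> level k m n (s + 1)" and x: "(a0, b0, 1) \<in> X"
    and s: "k + 2 \<le> s" "m + 2 \<le> s" "k + m + n + 2 \<le> 2 * s"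
    and IH: "\<And>Y. Y \<subset> X \<Longrightarrow> card Y \<le> card (lower_shadow Y)"
  shows "card X \<le> card (lower_shadow X) \<and>
    (k + m + n + 3 \<le> 2 * s \<longrightarrow> card X < card (lower_shadow X))"
proof -
  obtain t X1 X2 where t: "1 \<le> t" "t \<le> n" and split: "X = X1 \<union> X2" "X1 \<inter> X2 = {}" "X1 \<noteq> {}"
    and T: "third ` X1 = {1..t}"
    and cs: "card (lower_shadow X) = card (lower_shadow X1) + card (lower_shadow X2)"
    by (rule consecutive_rows[OF X x])
  have X1: "X1 \<subseteq> level k m n (s + 1)" using X split(1) by blast
  have fin: "finite X" by (rule finite_subset_level[OF X])
  have "X2 \<subset> X" using split by blast
  then have 2: "card X2 \<le> card (lower_shadow X2)" by (rule IH)
  have cX: "card X = card X1 + card X2" using fin split(2) unfolding split(1) by (simp add: card_Un_disjoint)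
  obtain U where "U \<subseteq> lower_shadow X1"
    "card X1 + card (third ` X1) = card U + card {x \<in> X1. fst x = 1} + card {x \<in> X1. fst (snd x) = 1}"
    by (rule row_shadow[OF X1])
  moreover from this have "card U \<le> card (lower_shadow X1)"
    using finite_lower_shadow[OF X1] by (intro card_mono)
  ultimately have "card X1 + t \<le> card (lower_shadow X1) + (t - (s - m - 1)) + (t - (s - k - 1))"
    using face_bounds[OF X1 T s(2,1)] T by simp
  then show ?thesis using 2 cs cX t s by linarith
qed

section \<open>Coordinate permutations\<close>

definition swap13 :: "nat \<times> nat \<times> nat \<Rightarrow> nat \<times> nat \<times> nat" where
  "swap13 = (\<lambda>(a, b, c). (c, b, a))"

definition swap23 :: "nat \<times> nat \<times> nat \<Rightarrow> nat \<times> nat \<times> nat" where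
  "swap23 = (\<lambda>(a, b, c). (a, c, b))"

lemma swap_simps [simp]: "swap13 (a, b, c) = (c, b, a)" "swap23 (a, b, c) = (a, c, b)"
  by (simp_all add: swap13_def swap23_def)

lemma swap_swap: "swap13 (swap13 x) = x" "swap23 (swap23 x) = x"
  by (cases x; simp)+

lemma in_image_involution: "(\<And>x. f (f x) = x) \<Longrightarrow> x \<in> f ` X \<longleftrightarrow> f x \<in> X"
  by (metis image_iff)

lemma lower_shadow_swap:
  "lower_shadow (swap13 ` X) = swap13 ` lower_shadow X"
  "lower_shadow (swap23 ` X) = swap23 ` lower_shadow X"
proof -
  have "z \<in> lower_shadow (swap13 ` X) \<longleftrightarrow> z \<in> swap13 ` lower_shadow X" for z
    by (cases z) (auto simp only: in_lower_shadow in_image_involution[of swap13, OF swap_swap(1)] swap_simps)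
  then show "lower_shadow (swap13 ` X) = swap13 ` lower_shadow X" by blast
  have "z \<in> lower_shadow (swap23 ` X) \<longleftrightarrow> z \<in> swap23 ` lower_shadow X" for z
    by (cases z) (auto simp only: in_lower_shadow in_image_involution[of swap23, OF swap_swap(2)] swap_simps)
  then show "lower_shadow (swap23 ` X) = swap23 ` lower_shadow X" by blast
qed

lemma level_swap:
  "swap13 ` level k m n s = level n m k s" "swap23 ` level k m n s = level k n m s"
proof -
  have "z \<in> swap13 ` level k m n s \<longleftrightarrow> z \<in> level n m k s" for z
    by (cases z) (auto simp only: in_level in_image_involution[of swap13, OF swap_swap(1)] swap_simps)
  then show "swap13 ` level k m n s = level n m k s" by blast
  have "z \<in> swap23 ` level k m n s \<longleftrightarrow> z \<in> level k n m s" for z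
    by (cases z) (auto simp only: in_level in_image_involution[of swap23, OF swap_swap(2)] swap_simps)
  then show "swap23 ` level k m n s = level k n m s" by blast
qed

lemma card_image_involution: "(\<And>x. f (f x) = x) \<Longrightarrow> card (f ` X) = card X"
  by (metis card_image inj_on_inverseI)

lemma psubset_image_involution:
  assumes f: "\<And>x. f (f x) = x" and Y: "Y \<subset> f ` X"
  shows "f ` Y \<subset> X"
proof
  show "f ` Y \<subseteq> X"
  proof
    fix x assume "x \<in> f ` Y"
    then have "f x \<in> f ` X" using Y in_image_involution[of f, OF f] by blast
    then show "x \<in> X" using in_image_involution[of f, OF f] f by simp
  qed
  show "f ` Y \<noteq> X"
  proof
    assume "f ` Y = X"
    then have "f ` X = f ` f ` Y" by simp
    also have "\<dots> = Y" by (simp add: image_image f)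
    finally show False using Y by blast
  qed
qed

lemma card_swap:
  "card (swap13 ` Y) = card Y" "card (swap23 ` Y) = card Y"
  "card (lower_shadow (swap13 ` Y)) = card (lower_shadow Y)"
  "card (lower_shadow (swap23 ` Y)) = card (lower_shadow Y)"
  unfolding lower_shadow_swap
  by (simp_all only: card_image_involution[of swap13, OF swap_swap(1)]
    card_image_involution[of swap23, OF swap_swap(2)])

lemma lower_shadow_empty: "lower_shadow {} = {}"
  by (simp add: lower_shadow_def)

text \<open>Away from the faces every row gains a point. A second gain comes from lowering the third
  coordinate of a point in the lowest row, since this leads to a row that \<open>U\<close> does not
  meet.\<close>

lemma interior_shadow:
  assumes X: "X \<subseteq> level k m n (s + 1)" and "X \<noteq> {}"
    and "\<And>a b c. (a, b, c) \<in> X \<Longrightarrow> a \<noteq> 1 \<and> b \<noteq> 1 \<and> c \<noteq> 1"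
  shows "card X + 2 \<le> card (lower_shadow X)"
proof -
  let ?T = "third ` X"
  have fin: "finite X" by (rule finite_subset_level[OF X])
  obtain U where U: "U \<subseteq> lower_shadow X"
    "card X + card ?T = card U + card {x \<in> X. fst x = 1} + card {x \<in> X. fst (snd x) = 1}"
    "\<forall>a b c. (a, b, c) \<in> U \<longrightarrow> c \<in> ?T \<and>
      ((a, b + 1, c) \<in> X \<or> (a + 1, b, c) \<in> X \<and> (\<forall>a' b'. (a', b', c) \<in> X \<longrightarrow> a < a'))"
    by (rule row_shadow[OF X])
  have e: "{x \<in> X. fst x = 1} = {}" "{x \<in> X. fst (snd x) = 1} = {}"
    using assms(3) by fastforce+
  have cU: "card X + card ?T = card U" using U(2) unfolding e by simp
  have T: "finite ?T" "?T \<noteq> {}" using fin assms(2) by auto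
  have "Min ?T \<in> ?T" by (rule Min_in[OF T])
  then obtain x where x: "x \<in> X" "third x = Min ?T" by auto
  obtain a b c where abc: "x = (a, b, c)" by (cases x)
  have lev: "1 \<le> a" "1 \<le> b" "1 \<le> c"
    using subsetD[OF X x(1)] unfolding abc in_level by simp_all
  then have c: "c \<ge> 2" "c = Min ?T" using assms(3)[of a b c] x unfolding abc by auto
  have "(a, b, c - 1) \<in> lower_shadow X"
    using lev c x unfolding in_lower_shadow abc by auto
  moreover have "(a, b, c - 1) \<notin> U"
  proof
    assume "(a, b, c - 1) \<in> U"
    then have "c - 1 \<in> ?T" using U(3) by blast
    then have "c \<le> c - 1" unfolding c(2) using T(1) by simp
    then show False using c by simp
  qed
  ultimately have "card (insert (a, b, c - 1) U) \<le> card (lower_shadow X)"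
    using U(1) finite_lower_shadow[OF X] by (intro card_mono) auto
  moreover have "finite U" using U(1) finite_lower_shadow[OF X] by (rule finite_subset)
  moreover have "card ?T \<ge> 1" using T by (simp add: Suc_le_eq card_gt_0_iff)
  ultimately show ?thesis using \<open>(a, b, c - 1) \<notin> U\<close> cU by simp
qed

lemma touching_cases:
  fixes X :: "(nat \<times> nat \<times> nat) set"
  obtains (third) a b where "(a, b, 1) \<in> X" | (first) a b where "(a, b, 1) \<in> swap13 ` X"
    | (second) a b where "(a, b, 1) \<in> swap23 ` X"
    | (none) "\<And>a b c. (a, b, c) \<in> X \<Longrightarrow> a \<noteq> 1 \<and> b \<noteq> 1 \<and> c \<noteq> 1"
proof (cases "\<forall>a b c. (a, b, c) \<in> X \<longrightarrow> a \<noteq> 1 \<and> b \<noteq> 1 \<and> c \<noteq> 1")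
  case True
  then show thesis using none by blast
next
  case False
  then obtain a b c where x: "(a, b, c) \<in> X" "a = 1 \<or> b = 1 \<or> c = 1" by blast
  have "(c, b, a) \<in> swap13 ` X" "(a, c, b) \<in> swap23 ` X"
    unfolding in_image_involution[of swap13, OF swap_swap(1)] in_image_involution[of swap23, OF swap_swap(2)]
    using x(1) by simp_all
  then show thesis using x first second third by blast
qed

text \<open>Induction on \<open>X\<close>. If some face is touched, a swap makes it the face
  \<open>c = 1\<close>, on which the row count is based; otherwise \<open>interior_shadow\<close>
  applies.\<close>

lemma shadow_grows:
  assumes X: "X \<subseteq> level k m n (s + 1)" "X \<noteq> {}"
    and s: "k + 2 \<le> s" "m + 2 \<le> s" "n + 2 \<le> s" "k + m + n + 2 \<le> 2 * s"
  shows "card X \<le> card (lower_shadow X) \<and>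
    (k + m + n + 3 \<le> 2 * s \<longrightarrow> card X < card (lower_shadow X))"
proof -
  have "finite X" by (rule finite_subset_level[OF X(1)])
  then show ?thesis
    using X
  proof (induction X rule: finite_psubset_induct)
    case (psubset X)
    have IH: "card Y \<le> card (lower_shadow Y)" if "Y \<subset> X" for Y
      using psubset.IH[OF that] psubset.prems(1) that
      by (cases "Y = {}") (auto simp: lower_shadow_empty)
    show ?case
    proof (cases X rule: touching_cases)
      case third
      then show ?thesis
        using shadow_grows_touching[OF psubset.prems(1) _ s(1,2,4) IH] by blast
    next
      case (first a b)
      have IH': "card Y \<le> card (lower_shadow Y)" if "Y \<subset> swap13 ` X" for Y
        using IH[OF psubset_image_involution[OF swap_swap(1) that]] by (simp only: card_swap)
      have "swap13 ` X \<subseteq> level n m k (s + 1)"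
        using psubset.prems(1) by (metis image_mono level_swap(1))
      from shadow_grows_touching[OF this first s(3,2) _ IH'] s(4) show ?thesis
        by (simp only: card_swap) (simp add: add.commute add.left_commute)
    next
      case (second a b)
      have IH': "card Y \<le> card (lower_shadow Y)" if "Y \<subset> swap23 ` X" for Y
        using IH[OF psubset_image_involution[OF swap_swap(2) that]] by (simp only: card_swap)
      have "swap23 ` X \<subseteq> level k n m (s + 1)"
        using psubset.prems(1) by (metis image_mono level_swap(2))
      from shadow_grows_touching[OF this second s(1,3) _ IH'] s(4) show ?thesis
        by (simp only: card_swap) (simp add: add.commute add.left_commute)
    next
      case none
      then show ?thesis using interior_shadow[OF psubset.prems] by fastforce
    qed
  qed
qed

section \<open>Tight sets\<close>

text \<open>If the shadow is no larger than the set \<open>U\<close> from \<open>row_shadow\<close>,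
  rows have no gaps: the point \<open>(a, b, c)\<close> belongs to \<open>U\<close>, and being no
  new end point of its row it must come from \<open>(a, b + 1, c)\<close>.\<close>

lemma tight_row_step:
  assumes "lower_shadow X = U"
    and "\<forall>a b c. (a, b, c) \<in> U \<longrightarrow> c \<in> third ` X \<and>
      ((a, b + 1, c) \<in> X \<or> (a + 1, b, c) \<in> X \<and> (\<forall>a' b'. (a', b', c) \<in> X \<longrightarrow> a < a'))"
    and "(a + 1, b, c) \<in> X" "1 \<le> a" "1 \<le> b" "1 \<le> c" "(a', b', c) \<in> X" "a' \<le> a"
  shows "(a, b + 1, c) \<in> X"
proof -
  have "(a, b, c) \<in> U" using assms(3-6) unfolding assms(1)[symmetric] in_lower_shadow by blast
  then show ?thesis using assms(2,7,8) by (meson not_less)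
qed

text \<open>Such an \<open>X\<close> is an interval of the row \<open>c = 1\<close>; the coordinates
  of \<open>t\<close> are the maxima at its two ends.\<close>

lemma tight_single_row:
  assumes X: "X \<subseteq> level k m n (s + 1)" and T: "third ` X = {1}"
    and U: "lower_shadow X = U" "\<forall>a b c. (a, b, c) \<in> U \<longrightarrow> c \<in> third ` X \<and>
      ((a, b + 1, c) \<in> X \<or> (a + 1, b, c) \<in> X \<and> (\<forall>a' b'. (a', b', c) \<in> X \<longrightarrow> a < a'))"
  shows "\<exists>t\<in>grid k m n. s < rk t \<and> third t = 1 \<and> X = {x \<in> level k m n (s + 1). x \<le> t}"
proof -
  have fin: "finite X" by (rule finite_subset_level[OF X])
  have lev: "1 \<le> a \<and> a \<le> k \<and> 1 \<le> b \<and> b \<le> m \<and> 1 \<le> n \<and> c = 1 \<and> a + b = s" if x: "(a, b, c) \<in> X" for a b c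
  proof -
    have "c \<in> third ` X" using x by force
    then have "c = 1" using T by simp
    then show ?thesis using subsetD[OF X x] unfolding in_level by simp
  qed
  have ne: "X \<noteq> {}" using T by auto
  let ?a = "Max (fst ` X)" and ?b = "Max ((fst \<circ> snd) ` X)"
  have "?a \<in> fst ` X" "?b \<in> (fst \<circ> snd) ` X"
    using fin ne by (intro Max_in; simp)+
  then obtain x y where x: "x \<in> X" "fst x = ?a" and y: "y \<in> X" "fst (snd y) = ?b" by auto
  have le: "a \<le> ?a" "b \<le> ?b" if z: "(a, b, c) \<in> X" for a b c
  proof -
    have "fst (a, b, c) \<in> fst ` X" "(fst \<circ> snd) (a, b, c) \<in> (fst \<circ> snd) ` X" using z by blast+
    then show "a \<le> ?a" "b \<le> ?b" using fin by auto
  qed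
  have x1: "(?a, s - ?a, 1) \<in> X"
    using x lev[of "fst x" "fst (snd x)" "third x"] by (cases x) auto
  have y1: "(s - ?b, ?b, 1) \<in> X"
    using y lev[of "fst y" "fst (snd y)" "third y"] by (cases y) auto
  \<comment> \<open>The walk goes from the end with the largest first coordinate towards the end
    \<open>y1\<close>.\<close>
  have down: "(?a - i, s - (?a - i), 1) \<in> X" if "s - ?b \<le> ?a - i" for i
    using that
  proof (induction i)
    case 0
    then show ?case using x1 by simp
  next
    case (Suc i)
    have i: "(?a - i, s - (?a - i), 1) \<in> X" using Suc by simp
    show ?case
    proof (cases "i < ?a")
      case False
      then show ?thesis using i by simp
    next
      case True
      then have a: "?a - i = (?a - Suc i) + 1" by simp
      have "(?a - Suc i, s - (?a - i) + 1, 1) \<in> X"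
      proof (rule tight_row_step[OF U _ _ _ _ y1 Suc.prems])
        show "(?a - Suc i + 1, s - (?a - i), 1) \<in> X" using i a by simp
        show "1 \<le> ?a - Suc i" using Suc.prems lev[OF y1] by simp
        show "1 \<le> s - (?a - i)" using lev[OF i] by simp
      qed simp
      moreover have "s - (?a - i) + 1 = s - (?a - Suc i)"
      proof -
        have "?a - i \<le> s" using lev[OF i] by linarith
        then show ?thesis using a by linarith
      qed
      ultimately show ?thesis by (simp only:)
    qed
  qed
  have "X = {x \<in> level k m n (s + 1). x \<le> (?a, ?b, 1)}"
  proof (intro equalityI subsetI)
    fix z assume z: "z \<in> X"
    obtain a b c where abc: "z = (a, b, c)" by (cases z)
    show "z \<in> {x \<in> level k m n (s + 1). x \<le> (?a, ?b, 1)}"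
      using subsetD[OF X z] le[of a b c] lev[of a b c] z unfolding abc by simp
  next
    fix z assume z: "z \<in> {x \<in> level k m n (s + 1). x \<le> (?a, ?b, 1)}"
    obtain a b c where abc: "z = (a, b, c)" by (cases z)
    have *: "(a, b, c) \<in> level k m n (s + 1)" "a \<le> ?a" "b \<le> ?b" "c \<le> 1" using z unfolding abc by auto
    then have c: "c = 1" "a + b = s" unfolding in_level by auto
    have a: "?a - (?a - a) = a" and b: "s - a = b" using * c by auto
    have "s - ?b \<le> a" using * c by linarith
    then show "z \<in> X" using down[of "?a - a"] unfolding abc c a b by simp
  qed
  moreover have "(?a, ?b, 1) \<in> grid k m n"
    unfolding in_grid using lev[OF x1] lev[OF y1] by simp
  moreover have "s < rk (?a, ?b, 1)"
    using lev[OF x1] le(2)[OF x1] by simp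
  moreover have "third (?a, ?b, 1) = 1" by simp
  ultimately show ?thesis by (intro bexI[of _ "(?a, ?b, 1)"] conjI)
qed

text \<open>The top row contains both its ends by \<open>A\<close> and \<open>B\<close> and so is
  full. A full row \<open>c + 1\<close> puts \<open>(a, b - 1, c)\<close> and
  \<open>(a - 1, b, c)\<close> into the shadow; as the shadow is only \<open>U\<close>, this forces
  \<open>(a, b, c)\<close> into \<open>X\<close>, and the fullness descends row by row.\<close>

lemma tight_all_rows:
  assumes X: "X \<subseteq> level k m n (s + 1)" and s: "m + 3 \<le> s" "k + 3 \<le> s" "k + m + n + 3 = 2 * s"
    and U: "lower_shadow X = U" "\<forall>a b c. (a, b, c) \<in> U \<longrightarrow> c \<in> third ` X \<and>
      ((a, b + 1, c) \<in> X \<or> (a + 1, b, c) \<in> X \<and> (\<forall>a' b'. (a', b', c) \<in> X \<longrightarrow> a < a'))"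
    and A: "\<And>c. s \<le> m + c \<Longrightarrow> c \<le> n \<Longrightarrow> (1, s - c, c) \<in> X"
    and B: "\<And>c. s \<le> k + c \<Longrightarrow> c \<le> n \<Longrightarrow> (s - c, 1, c) \<in> X"
  shows "X = level k m n (s + 1)"
proof -
  have lev: "1 \<le> a \<and> 1 \<le> b \<and> 1 \<le> c \<and> a + b + c = s + 1" if "(a, b, c) \<in> X" for a b c
    using subsetD[OF X that] unfolding in_level by simp
  have top: "(s - n - i, i + 1, n) \<in> X" if "i < s - n" for i
    using that
  proof (induction i)
    case 0
    then show ?case using B[of n] s by simp
  next
    case (Suc i)
    have "(s - n - Suc i, (i + 1) + 1, n) \<in> X"
    proof (rule tight_row_step[OF U])
      show "(s - n - Suc i + 1, i + 1, n) \<in> X" using Suc by (simp add: Suc_diff_Suc)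
      show "(1, s - n, n) \<in> X" by (rule A) (use s in auto)
      show "1 \<le> s - n - Suc i" using Suc.prems by simp
      then show "1 \<le> s - n - Suc i" .
      show "1 \<le> n" using lev[OF \<open>(1, s - n, n) \<in> X\<close>] by simp
    qed simp
    then show ?case by simp
  qed
  have row: "(a, b, n - i) \<in> X" if "(a, b, n - i) \<in> level k m n (s + 1)" for a b i
    using that
  proof (induction i arbitrary: a b)
    case 0
    then have "b - 1 < s - n" "s - n - (b - 1) = a" "b - 1 + 1 = b" unfolding in_level by auto
    then show ?case using top[of "b - 1"] by simp
  next
    case (Suc i)
    show ?case
    proof (cases "i < n")
      case False
      then show ?thesis using Suc by simp
    next
      case True
      define c where "c = n - Suc i"
      have ci: "n - i = c + 1" using True by (simp add: c_def)
      have ab: "1 \<le> a" "a \<le> k" "1 \<le> b" "b \<le> m" "1 \<le> c" "c + 1 \<le> n" "a + b + c = s + 1"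
        using Suc.prems True unfolding c_def[symmetric] in_level by (auto simp: c_def)
      have IH: "(a', b', c + 1) \<in> X" if "1 \<le> a'" "a' \<le> k" "1 \<le> b'" "b' \<le> m" "a' + b' + c = s" for a' b'
        using Suc.IH[of a' b'] that ab(6) unfolding ci in_level by simp
      have "(a, b, c) \<in> X"
      proof (cases "b = 1")
        case True
        then have "a = s - c" "s \<le> k + c" using ab by auto
        then show ?thesis using B[of c] ab True by simp
      next
        case b: False
        have "(a, b - 1, c) \<in> lower_shadow X"
          unfolding in_lower_shadow using IH[of a "b - 1"] ab b by auto
        then have "(a, b - 1 + 1, c) \<in> X \<or> (\<forall>a' b'. (a', b', c) \<in> X \<longrightarrow> a < a')"
          using U by blast
        then show ?thesis
        proof
          assume "(a, b - 1 + 1, c) \<in> X"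
          then show ?thesis using ab b by simp
        next
          assume no: "\<forall>a' b'. (a', b', c) \<in> X \<longrightarrow> a < a'"
          show ?thesis
          proof (cases "a = 1")
            case True
            then have "(1, s - c, c) \<in> X" using ab by (intro A) auto
            then show ?thesis using no True by blast
          next
            case a: False
            have "(a - 1, b, c) \<in> lower_shadow X"
              unfolding in_lower_shadow using IH[of "a - 1" b] ab a by auto
            then have "(a - 1, b + 1, c) \<in> X \<or> (a - 1 + 1, b, c) \<in> X" using U by blast
            then show ?thesis
            proof
              assume "(a - 1, b + 1, c) \<in> X"
              then have "a < a - 1" using no by blast
              then show ?thesis by simp
            next
              assume "(a - 1 + 1, b, c) \<in> X"
              then show ?thesis using ab by simp
            qed
          qed
        qed
      qed
      then show ?thesis by (simp add: c_def)
    qed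
  qed
  show ?thesis
  proof (intro equalityI X subsetI)
    fix z assume z: "z \<in> level k m n (s + 1)"
    obtain a b c where abc: "z = (a, b, c)" by (cases z)
    have "c \<le> n" using z unfolding abc in_level by simp
    then show "z \<in> X" using row[of a b "n - c"] z unfolding abc by simp
  qed
qed

lemma tight_touching:
  assumes X: "X \<subseteq> level k m n (s + 1)" and x: "(a0, b0, 1) \<in> X"
    and s: "k + 3 \<le> s" "m + 3 \<le> s" "k + m + n + 3 = 2 * s"
    and IH: "\<And>Y. Y \<subset> X \<Longrightarrow> Y \<noteq> {} \<Longrightarrow> card Y < card (lower_shadow Y)"
    and tight: "card (lower_shadow X) = card X + 1"
  shows "X = level k m n (s + 1) \<or>
    (\<exists>t\<in>grid k m n. s < rk t \<and> third t = 1 \<and> X = {x \<in> level k m n (s + 1). x \<le> t})"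
proof -
  obtain t X1 X2 where t: "1 \<le> t" "t \<le> n" and split: "X = X1 \<union> X2" "X1 \<inter> X2 = {}" "X1 \<noteq> {}"
    and T: "third ` X1 = {1..t}"
    and cs: "card (lower_shadow X) = card (lower_shadow X1) + card (lower_shadow X2)"
    by (rule consecutive_rows[OF X x])
  have fin: "finite X" by (rule finite_subset_level[OF X])
  have "X2 = {}"
  proof (rule ccontr)
    assume "X2 \<noteq> {}"
    then have "card X1 < card (lower_shadow X1)" "card X2 < card (lower_shadow X2)"
      using split by (intro IH; blast)+
    moreover have "card X = card X1 + card X2"
      using fin split(2) unfolding split(1) by (simp add: card_Un_disjoint)
    ultimately show False using tight cs by simp
  qed
  then have T: "third ` X = {1..t}" using T split(1) by simp
  obtain U where U: "U \<subseteq> lower_shadow X"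
    "card X + card (third ` X) = card U + card {x \<in> X. fst x = 1} + card {x \<in> X. fst (snd x) = 1}"
    "\<forall>a b c. (a, b, c) \<in> U \<longrightarrow> c \<in> third ` X \<and>
      ((a, b + 1, c) \<in> X \<or> (a + 1, b, c) \<in> X \<and> (\<forall>a' b'. (a', b', c) \<in> X \<longrightarrow> a < a'))"
    by (rule row_shadow[OF X])
  have cU: "card U \<le> card X + 1"
    using card_mono[OF finite_lower_shadow[OF X] U(1)] tight by simp
  have bounds: "card {x \<in> X. fst x = 1} \<le> t - (s - m - 1)" "card {x \<in> X. fst (snd x) = 1} \<le> t - (s - k - 1)"
    using face_bounds[OF X T] s by auto
  have eq: "card X + t = card U + card {x \<in> X. fst x = 1} + card {x \<in> X. fst (snd x) = 1}"
    using U(2) unfolding T by simp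
  have "t \<le> 1 + (t - (s - m - 1)) + (t - (s - k - 1))" using eq cU bounds by linarith
  \<comment> \<open>If both differences are positive, the right side is \<open>2 * t - n\<close>, so
    \<open>t = n\<close>. Exactly one positive difference is impossible because
    \<open>s - m - 1\<close> and \<open>s - k - 1\<close> are at least \<open>2\<close>; with none,
    \<open>t = 1\<close>.\<close>
  then have tt: "t = 1 \<or> t = n" using t s by arith
  have le: "(t - (s - m - 1)) + (t - (s - k - 1)) \<le> t - 1" using t s by arith
  then have cU': "card U = card X + 1" using eq cU bounds t by linarith
  then have shU: "lower_shadow X = U"
    using card_subset_eq[OF finite_lower_shadow[OF X] U(1)] tight by simp
  show ?thesis
    using tt
  proof
    assume "t = 1"
    then show ?thesis using tight_single_row[OF X _ shU U(3)] T by simp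
  next
    assume tn: "t = n"
    \<comment> \<open>For \<open>t = n\<close> the two bounds add up to precisely the required loss,
      so both are attained and every possible point of the faces \<open>a = 1\<close> and
      \<open>b = 1\<close> is present.\<close>
    have n1: "(n - (s - m - 1)) + (n - (s - k - 1)) = n - 1" using s by arith
    have cA: "card {x \<in> X. fst x = 1} = n - (s - m - 1)" and cB: "card {x \<in> X. fst (snd x) = 1} = n - (s - k - 1)"
      using eq cU' bounds n1 t unfolding tn by linarith+
    have "third ` {x \<in> X. fst x = 1} = {s - m..n}"
      using card_first_face(3,5)[OF X] cA s T unfolding tn by (intro card_subset_eq) auto
    moreover have "third ` {x \<in> X. fst (snd x) = 1} = {s - k..n}"
      using card_first_face(4,6)[OF X] cB s T unfolding tn by (intro card_subset_eq) auto
    ultimately have third: "third ` {x \<in> X. fst x = 1} = {s - m..n}"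
      "third ` {x \<in> X. fst (snd x) = 1} = {s - k..n}" .
    have lev: "a + b + c = s + 1" if "(a, b, c) \<in> X" for a b c
      using subsetD[OF X that] unfolding in_level by simp
    have "(1, s - c, c) \<in> X" if "s \<le> m + c" "c \<le> n" for c
    proof -
      have "c \<in> third ` {x \<in> X. fst x = 1}" unfolding third using that by simp
      then obtain b where b: "(1, b, c) \<in> X" by auto
      moreover have "b = s - c" using lev[OF b] by simp
      ultimately show ?thesis by simp
    qed
    moreover have "(s - c, 1, c) \<in> X" if "s \<le> k + c" "c \<le> n" for c
    proof -
      have "c \<in> third ` {x \<in> X. fst (snd x) = 1}" unfolding third using that by simp
      then obtain a where a: "(a, 1, c) \<in> X" by auto
      moreover have "a = s - c" using lev[OF a] by simp
      ultimately show ?thesis by simp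
    qed
    ultimately have "X = level k m n (s + 1)"
      using tight_all_rows[OF X s(2,1,3) shU U(3)] by blast
    then show ?thesis ..
  qed
qed

section \<open>Short grids\<close>

lemma swap_below:
  "swap13 ` {x \<in> level n m k s. x \<le> t} = {x \<in> level k m n s. x \<le> swap13 t}"
  "swap23 ` {x \<in> level k n m s. x \<le> t} = {x \<in> level k m n s. x \<le> swap23 t}"
proof -
  obtain a b c where t: "t = (a, b, c)" by (cases t)
  have "z \<in> swap13 ` {x \<in> level n m k s. x \<le> t} \<longleftrightarrow> z \<in> {x \<in> level k m n s. x \<le> swap13 t}" for z
    unfolding in_image_involution[of swap13, OF swap_swap(1)] t
    by (cases z) (auto simp: in_level)
  then show "swap13 ` {x \<in> level n m k s. x \<le> t} = {x \<in> level k m n s. x \<le> swap13 t}" by blast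
  have "z \<in> swap23 ` {x \<in> level k n m s. x \<le> t} \<longleftrightarrow> z \<in> {x \<in> level k m n s. x \<le> swap23 t}" for z
    unfolding in_image_involution[of swap23, OF swap_swap(2)] t
    by (cases z) (auto simp: in_level)
  then show "swap23 ` {x \<in> level k n m s. x \<le> t} = {x \<in> level k m n s. x \<le> swap23 t}" by blast
qed

lemma swap_in_grid:
  "t \<in> grid n m k \<Longrightarrow> swap13 t \<in> grid k m n" "t \<in> grid k n m \<Longrightarrow> swap23 t \<in> grid k m n"
  by (cases t; simp)+

text \<open>An interior set gains at least two points, so a tight set touches a face; a swap reduces
  to the face \<open>c = 1\<close>. What matters later is that there are at most as many candidates
  as points \<open>t\<close> on the faces above the middle, plus one.\<close>

lemma tight_sets:
  assumes X: "X \<subseteq> level k m n (s + 1)" and ne: "X \<noteq> {}"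
    and s: "k + 3 \<le> s" "m + 3 \<le> s" "n + 3 \<le> s" "k + m + n + 3 = 2 * s"
    and tight: "card (lower_shadow X) = card X + 1"
  shows "X \<in> insert (level k m n (s + 1)) ((\<lambda>t. {x \<in> level k m n (s + 1). x \<le> t}) `
    {t \<in> grid k m n. s < rk t \<and> (fst t = 1 \<or> fst (snd t) = 1 \<or> third t = 1)})"
proof (cases X rule: touching_cases)
  case third
  have IH: "card Y < card (lower_shadow Y)" if "Y \<subset> X" "Y \<noteq> {}" for Y
    using shadow_grows[of Y k m n s] X that s by auto
  show ?thesis
    using tight_touching[OF X third s(1,2,4) IH tight] by blast
next
  case (first a b)
  have X': "swap13 ` X \<subseteq> level n m k (s + 1)"
    using image_mono[OF X, of swap13] unfolding level_swap(1) .
  have IH: "card Y < card (lower_shadow Y)" if "Y \<subset> swap13 ` X" "Y \<noteq> {}" for Y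
    using shadow_grows[of Y n m k s] X' that s by auto
  have inverse: "X = swap13 ` (swap13 ` X)" by (simp add: image_image swap_swap)
  have "swap13 ` X = level n m k (s + 1) \<or>
    (\<exists>t\<in>grid n m k. s < rk t \<and> third t = 1 \<and> swap13 ` X = {x \<in> level n m k (s + 1). x \<le> t})"
    by (rule tight_touching[OF X' first s(3,2) _ IH]) (use s tight in \<open>auto simp: card_swap\<close>)
  then show ?thesis
  proof (elim disjE bexE conjE)
    assume "swap13 ` X = level n m k (s + 1)"
    then have "X = level k m n (s + 1)" by (subst inverse, simp only: level_swap)
    then show ?thesis by simp
  next
    fix t assume t: "t \<in> grid n m k" "s < rk t" "third t = 1"
      and X_t: "swap13 ` X = {x \<in> level n m k (s + 1). x \<le> t}"
    have "X = {x \<in> level k m n (s + 1). x \<le> swap13 t}"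
      by (subst inverse, simp only: X_t swap_below)
    moreover have "swap13 t \<in> {t \<in> grid k m n. s < rk t \<and> (fst t = 1 \<or> fst (snd t) = 1 \<or> third t = 1)}"
      using swap_in_grid(1)[OF t(1)] t(2,3) by (cases t) (auto simp: add.commute add.left_commute)
    ultimately show ?thesis by (intro insertI2 image_eqI[where x = "swap13 t"])
  qed
next
  case (second a b)
  have X': "swap23 ` X \<subseteq> level k n m (s + 1)"
    using image_mono[OF X, of swap23] unfolding level_swap(2) .
  have IH: "card Y < card (lower_shadow Y)" if "Y \<subset> swap23 ` X" "Y \<noteq> {}" for Y
    using shadow_grows[of Y k n m s] X' that s by auto
  have inverse: "X = swap23 ` (swap23 ` X)" by (simp add: image_image swap_swap)
  have "swap23 ` X = level k n m (s + 1) \<or>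
    (\<exists>t\<in>grid k n m. s < rk t \<and> third t = 1 \<and> swap23 ` X = {x \<in> level k n m (s + 1). x \<le> t})"
    by (rule tight_touching[OF X' second s(1,3) _ IH]) (use s tight in \<open>auto simp: card_swap\<close>)
  then show ?thesis
  proof (elim disjE bexE conjE)
    assume "swap23 ` X = level k n m (s + 1)"
    then have "X = level k m n (s + 1)" by (subst inverse, simp only: level_swap)
    then show ?thesis by simp
  next
    fix t assume t: "t \<in> grid k n m" "s < rk t" "third t = 1"
      and X_t: "swap23 ` X = {x \<in> level k n m (s + 1). x \<le> t}"
    have "X = {x \<in> level k m n (s + 1). x \<le> swap23 t}"
      by (subst inverse, simp only: X_t swap_below)
    moreover have "swap23 t \<in> {t \<in> grid k m n. s < rk t \<and> (fst t = 1 \<or> fst (snd t) = 1 \<or> third t = 1)}"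
      using swap_in_grid(2)[OF t(1)] t(2,3) by (cases t) (auto simp: add.commute add.left_commute)
    ultimately show ?thesis by (intro insertI2 image_eqI[where x = "swap23 t"])
  qed
next
  case none
  then show ?thesis using interior_shadow[OF X ne] tight by fastforce
qed

text \<open>A point of \<open>A\<close> below a shadow point would lie below an element of
  \<open>X\<close>, hence equal it. In the other direction, shadow points have the maximal rank
  \<open>s\<close> of the new set.\<close>

lemma push_antichain:
  assumes A: "A \<in> antichains (grid k m n)" and rk: "\<And>x. x \<in> A \<Longrightarrow> rk x \<le> s + 1"
  defines "X \<equiv> {x \<in> A. rk x = s + 1}"
  shows "A - X \<union> lower_shadow X \<in> antichains (grid k m n)"
    and "X \<subseteq> level k m n (s + 1)"
    and "A \<inter> lower_shadow X = {}"
    and "card (A - X \<union> lower_shadow X) + card X = card A + card (lower_shadow X)"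
    and "\<And>x. x \<in> A - X \<union> lower_shadow X \<Longrightarrow> rk x \<le> s"
proof -
  have sub: "A \<subseteq> grid k m n" and eq: "\<And>x y. x \<in> A \<Longrightarrow> y \<in> A \<Longrightarrow> x \<le> y \<Longrightarrow> x = y"
    using A by (auto simp: antichains_iff)
  show X: "X \<subseteq> level k m n (s + 1)" using sub by (auto simp: X_def level_def)
  have sh: "rk z = s \<and> z \<in> grid k m n" if "z \<in> lower_shadow X" for z
    using subsetD[OF lower_shadow_level[OF X] that] by (simp add: level_def)
  show disj: "A \<inter> lower_shadow X = {}"
  proof (rule equals0I)
    fix z assume z: "z \<in> A \<inter> lower_shadow X"
    then obtain x where x: "x \<in> X" "z \<le> x" "rk x = rk z + 1" using lower_shadowE by blast
    then have "z = x" using eq[of z x] z by (simp add: X_def)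
    then show False using x(3) by simp
  qed
  show rk': "rk x \<le> s" if "x \<in> A - X \<union> lower_shadow X" for x
    using that
  proof
    assume "x \<in> A - X"
    then show ?thesis using rk[of x] by (auto simp: X_def)
  qed (use sh in simp)
  show "A - X \<union> lower_shadow X \<in> antichains (grid k m n)"
    unfolding antichains_iff
  proof (intro conjI ballI impI)
    show "A - X \<union> lower_shadow X \<subseteq> grid k m n" using sub sh by blast
    fix u v assume u: "u \<in> A - X \<union> lower_shadow X" and v: "v \<in> A - X \<union> lower_shadow X" and uv: "u \<le> v"
    show "u = v"
    proof (cases "u \<in> lower_shadow X")
      case True
      then show ?thesis using rk_le_eq[OF uv] rk'[OF v] sh by simp
    next
      case False
      then have uA: "u \<in> A" "u \<notin> X" using u by auto
      show ?thesis
      proof (cases "v \<in> lower_shadow X")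
        case True
        then obtain x where x: "x \<in> X" "v \<le> x" by (rule lower_shadowE)
        then have "u = x" using eq[of u x] uA uv by (auto simp: X_def)
        then show ?thesis using x uA by simp
      next
        case False
        then show ?thesis using v eq uA uv by blast
      qed
    qed
  qed
  have finA: "finite A" using finite_antichain[OF finite_grid A] .
  have "card (A - X \<union> lower_shadow X) = card (A - X) + card (lower_shadow X)"
    using finA finite_lower_shadow[OF X] disj by (intro card_Un_disjoint) auto
  moreover have "card (A - X) + card X = card A"
    using finA by (metis (no_types, lifting) X_def card_Diff_subset card_mono finite_subset le_add_diff_inverse2 mem_Collect_eq subsetI)
  ultimately show "card (A - X \<union> lower_shadow X) + card X = card A + card (lower_shadow X)" by simp
qed

lemma push_high_antichain:
  assumes A: "A \<in> antichains (grid k m n)" and x: "x \<in> A" "s < rk x"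
    and s: "k + 2 \<le> s" "m + 2 \<le> s" "n + 2 \<le> s" "k + m + n + 2 \<le> 2 * s"
  obtains r X where "s \<le> r" "X = {x \<in> A. rk x = r + 1}" "X \<noteq> {}" "X \<subseteq> level k m n (r + 1)"
    "A \<inter> lower_shadow X = {}"
    "A - X \<union> lower_shadow X \<in> antichains (grid k m n)"
    "card (A - X \<union> lower_shadow X) + card X = card A + card (lower_shadow X)"
    "\<forall>x\<in>A - X \<union> lower_shadow X. rk x \<le> r"
    "card X \<le> card (lower_shadow X)"
    "k + m + n + 3 \<le> 2 * s \<longrightarrow> card X < card (lower_shadow X)"
proof -
  have fin: "finite A" using finite_antichain[OF finite_grid A] .
  define r where "r = Max (rk ` A) - 1"
  have le: "rk y \<le> Max (rk ` A)" if "y \<in> A" for y using fin that by simp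
  then have r1: "r + 1 = Max (rk ` A)" and sr: "s \<le> r" using le[OF x(1)] x(2) by (auto simp: r_def)
  let ?X = "{x \<in> A. rk x = r + 1}"
  have "Max (rk ` A) \<in> rk ` A" using fin x(1) by (intro Max_in) auto
  then obtain y where "y \<in> A" "rk y = Max (rk ` A)" by (metis imageE)
  then have "y \<in> ?X" using r1 by simp
  then have ne: "?X \<noteq> {}" by blast
  have rk: "rk y \<le> r + 1" if "y \<in> A" for y using le[OF that] r1 by simp
  note push = push_antichain[OF A rk]
  show thesis
    by (rule that[OF sr refl ne push(2,3,1,4)])
      (use push(5) shadow_grows[OF push(2) ne] s sr in auto)
qed

lemma rk_flip:
  assumes "x \<in> grid k m n"
  shows "rk (flip k m n x) + rk x = k + m + n + 3"
proof -
  obtain a b c where x: "x = (a, b, c)" by (cases x)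
  show ?thesis using assms unfolding x in_grid flip_def by simp
qed

text \<open>The levels \<open>s\<close> and \<open>s + 1\<close> are both in the middle. Pushing
  loses nothing, so the unique maximal antichain stays at ranks up to \<open>s\<close>; it is also
  invariant under \<open>flip\<close>, which maps rank \<open>r\<close> to
  \<open>2 * s + 1 - r\<close>, a contradiction.\<close>

lemma grid_even_gap:
  assumes s: "k + 2 \<le> s" "m + 2 \<le> s" "n + 2 \<le> s" "k + m + n + 2 = 2 * s" and "1 \<le> k" "1 \<le> m" "1 \<le> n"
  shows "\<not> palindromic (antichain_poly (grid k m n))"
proof
  assume pal: "palindromic (antichain_poly (grid k m n))"
  obtain A where A: "A \<in> antichains (grid k m n)" and max: "\<forall>B\<in>antichains (grid k m n). card B \<le> card A"
    using max_antichain_exists[OF finite_grid] by blast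
  note unique = palindromic_unique_max[OF finite_grid pal A max]
  have low: "rk x \<le> s" if x: "x \<in> A" for x
  proof (rule ccontr)
    assume "\<not> rk x \<le> s"
    then have "s < rk x" by simp
    have s4: "k + m + n + 2 \<le> 2 * s" using s(4) by simp
    obtain r X where "s \<le> r" and X: "X = {x \<in> A. rk x = r + 1}" "X \<noteq> {}" "X \<subseteq> level k m n (r + 1)"
      "A \<inter> lower_shadow X = {}" "A - X \<union> lower_shadow X \<in> antichains (grid k m n)"
      "card (A - X \<union> lower_shadow X) + card X = card A + card (lower_shadow X)"
      "\<forall>x\<in>A - X \<union> lower_shadow X. rk x \<le> r" "card X \<le> card (lower_shadow X)"
      "k + m + n + 3 \<le> 2 * s \<longrightarrow> card X < card (lower_shadow X)"
      by (rule push_high_antichain[OF A x \<open>s < rk x\<close> s(1-3) s4])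
    have "A - X \<union> lower_shadow X = A" by (rule unique[OF X(5)]) (use X(6,8) in linarith)
    then have "\<forall>y\<in>A. rk y \<le> r" using X(7) by simp
    moreover obtain y where "y \<in> A" "rk y = r + 1" using X(1,2) by blast
    ultimately show False by fastforce
  qed
  have sub: "A \<subseteq> grid k m n" using A by (simp add: antichains_iff)
  have "{(1, 1, 1)} \<in> antichains (grid k m n)"
    using assms by (auto simp: antichains_iff chain_poset_def)
  then have "A \<noteq> {}" using max by fastforce
  then obtain x where x: "x \<in> A" by blast
  have "flip k m n ` A = A"
    by (rule unique[OF flip_antichain[OF A]]) (simp add: card_flip_image[OF sub])
  then have "flip k m n x \<in> A" using x by blast
  then show False using low[of x] low[of "flip k m n x"] x rk_flip[of x k m n] sub s(4) by auto
qed

lemma card_above_level: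
  assumes "k + m + n + 3 = 2 * s"
  shows "k * m * n = card (level k m n s) + 2 * card {t \<in> grid k m n. s < rk t}"
proof -
  let ?U = "{t \<in> grid k m n. s < rk t}" and ?D = "{t \<in> grid k m n. rk t < s}"
  have "flip k m n ` ?U = ?D"
  proof (intro equalityI subsetI)
    fix z assume "z \<in> flip k m n ` ?U"
    then obtain t where t: "t \<in> grid k m n" "s < rk t" "z = flip k m n t" by auto
    then show "z \<in> ?D" using rk_flip[OF t(1)] flip_in_grid[OF t(1)] assms by auto
  next
    fix z assume z: "z \<in> ?D"
    then have "flip k m n z \<in> ?U" using rk_flip[of z k m n] flip_in_grid[of z k m n] assms by auto
    moreover have "z = flip k m n (flip k m n z)" using flip_flip[of z k m n] z by simp
    ultimately show "z \<in> flip k m n ` ?U" by (rule rev_image_eqI)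
  qed
  then have "card ?D = card ?U" using card_flip_image[of ?U k m n] by auto
  moreover have "grid k m n = level k m n s \<union> (?U \<union> ?D)" by (auto simp: level_def)
  then have "card (grid k m n) = card (level k m n s \<union> (?U \<union> ?D))" by simp
  moreover have "card (level k m n s \<union> (?U \<union> ?D)) = card (level k m n s) + card (?U \<union> ?D)"
    by (rule card_Un_disjoint) (auto simp: level_def finite_grid)
  moreover have "card (?U \<union> ?D) = card ?U + card ?D"
    by (rule card_Un_disjoint) (auto simp: finite_grid)
  ultimately show ?thesis unfolding card_grid by simp
qed

lemma grid_odd_gap:
  assumes s: "k + 3 \<le> s" "m + 3 \<le> s" "n + 3 \<le> s" "k + m + n + 3 = 2 * s"
    and pos: "2 \<le> k" "2 \<le> m" "3 \<le> n"
  shows "\<not> palindromic (antichain_poly (grid k m n))"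
proof
  assume pal: "palindromic (antichain_poly (grid k m n))"
  let ?Q = "grid k m n" and ?M = "level k m n s"
  have s': "k + 2 \<le> s" "m + 2 \<le> s" "n + 2 \<le> s" "k + m + n + 2 \<le> 2 * s" "k + m + n + 3 \<le> 2 * s"
    using s by auto
  have "(1, s - n - 1, n) \<in> ?M" unfolding in_level using s pos by auto
  then have "card ?M \<noteq> 0" using finite_level[of k m n s] by auto
  then have M_pos: "1 \<le> card ?M" by simp
  \<comment> \<open>With a single middle level each push is a strict gain, so a maximal antichain
    has nothing above rank \<open>s\<close>, and by \<open>flip\<close> nothing below.\<close>
  have max_low: "rk x \<le> s" if A: "A \<in> antichains ?Q" "\<forall>B\<in>antichains ?Q. card B \<le> card A" and x: "x \<in> A" for A x
  proof (rule ccontr)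
    assume "\<not> rk x \<le> s"
    then have "s < rk x" by simp
    obtain r X where "s \<le> r" and X: "X = {x \<in> A. rk x = r + 1}" "X \<noteq> {}" "X \<subseteq> level k m n (r + 1)"
      "A \<inter> lower_shadow X = {}" "A - X \<union> lower_shadow X \<in> antichains (grid k m n)"
      "card (A - X \<union> lower_shadow X) + card X = card A + card (lower_shadow X)"
      "\<forall>x\<in>A - X \<union> lower_shadow X. rk x \<le> r" "card X \<le> card (lower_shadow X)"
      "k + m + n + 3 \<le> 2 * s \<longrightarrow> card X < card (lower_shadow X)"
      by (rule push_high_antichain[OF A(1) x \<open>s < rk x\<close> s'(1-4)])
    have "card (A - X \<union> lower_shadow X) \<le> card A" using A(2) X(5) by blast
    then show False using X(6,9) s'(5) by linarith
  qed
  have max_eq: "A = ?M" if A: "A \<in> antichains ?Q" "\<forall>B\<in>antichains ?Q. card B \<le> card A" for A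
  proof -
    have sub: "A \<subseteq> ?Q" using A(1) by (simp add: antichains_iff)
    have max': "\<forall>B\<in>antichains ?Q. card B \<le> card (flip k m n ` A)"
      using A(2) by (simp add: card_flip_image[OF sub])
    have "rk x = s" if x: "x \<in> A" for x
      using max_low[OF A x] max_low[OF flip_antichain[OF A(1)] max', of "flip k m n x"]
        rk_flip[OF subsetD[OF sub x]] x s(4) by simp
    then have "A \<subseteq> ?M" using sub by (auto simp: level_def)
    moreover have "card ?M \<le> card A" using A(2) level_antichain by blast
    ultimately show ?thesis using card_seteq[OF finite_level] by blast
  qed
  have M_max: "\<forall>B\<in>antichains ?Q. card B \<le> card ?M"
    using max_antichain_exists[OF finite_grid, of k m n] max_eq by blast
  have eq_M: "A = ?M" if "A \<in> antichains ?Q" "card ?M \<le> card A" for A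
    by (rule max_eq[OF that(1)]) (use M_max that(2) in \<open>meson le_trans\<close>)
  \<comment> \<open>\<open>TT\<close> lists the candidates for tight sets just above the middle,
    indexed by the face points in \<open>Z\<close> and one extra element for the whole level.
    \<open>\<Phi>\<close> exchanges the shadow of such a set within the middle level for the set
    itself.\<close>
  define Z where "Z = {t \<in> ?Q. s < rk t \<and> (fst t = 1 \<or> fst (snd t) = 1 \<or> third t = 1)}"
  define TT where "TT = insert (level k m n (s + 1)) ((\<lambda>t. {x \<in> level k m n (s + 1). x \<le> t}) ` Z)"
  define \<Phi> where "\<Phi> X = X \<union> (?M - lower_shadow X)" for X
  \<comment> \<open>One push already restores the size of \<open>?M\<close>, so it yields
    \<open>?M\<close> itself. Therefore the pushed points had rank \<open>s + 1\<close> and formed a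
    tight set.\<close>
  have high: "A \<in> \<Phi> ` TT" if A: "A \<in> antichains ?Q" "card A = card ?M - 1" and x: "x \<in> A" "s < rk x" for A x
  proof -
    obtain r X where r: "s \<le> r" and X: "X = {x \<in> A. rk x = r + 1}" "X \<noteq> {}" "X \<subseteq> level k m n (r + 1)"
      "A \<inter> lower_shadow X = {}" "A - X \<union> lower_shadow X \<in> antichains (grid k m n)"
      "card (A - X \<union> lower_shadow X) + card X = card A + card (lower_shadow X)"
      "\<forall>x\<in>A - X \<union> lower_shadow X. rk x \<le> r" "card X \<le> card (lower_shadow X)"
      "k + m + n + 3 \<le> 2 * s \<longrightarrow> card X < card (lower_shadow X)"
      by (rule push_high_antichain[OF A(1) x s'(1-4)])
    have less: "card X < card (lower_shadow X)" using X(9) s'(5) by simp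
    then have "card ?M \<le> card (A - X \<union> lower_shadow X)" using X(6) A(2) by linarith
    then have M: "A - X \<union> lower_shadow X = ?M" using eq_M[OF X(5)] by blast
    have "lower_shadow X \<noteq> {}" using less by auto
    then obtain z where z: "z \<in> lower_shadow X" by blast
    have "rk z = r" using subsetD[OF lower_shadow_level[OF X(3)] z] by (simp add: level_def)
    moreover have "rk z = s" using z M by (auto simp: level_def)
    ultimately have rs: "r = s" by simp
    have "card (lower_shadow X) = card X + 1" using X(6) A(2) M_pos unfolding M by linarith
    then have "X \<in> TT"
      unfolding TT_def Z_def using tight_sets[OF X(3)[unfolded rs] X(2) s] by blast
    moreover have "A - X = ?M - lower_shadow X" using M X(4) by blast
    then have "A = \<Phi> X" using X(1) unfolding \<Phi>_def by blast
    ultimately show ?thesis by blast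
  qed
  have cover: "{A \<in> antichains ?Q. card A = card ?M - 1} \<subseteq>
    (\<lambda>z. ?M - {z}) ` ?M \<union> (\<Phi> ` TT \<union> image (flip k m n) ` \<Phi> ` TT)"
  proof
    fix A assume "A \<in> {A \<in> antichains ?Q. card A = card ?M - 1}"
    then have A: "A \<in> antichains ?Q" "card A = card ?M - 1" by auto
    then have sub: "A \<subseteq> ?Q" by (simp add: antichains_iff)
    consider x where "x \<in> A" "s < rk x" | x where "x \<in> A" "rk x < s" | "\<forall>x\<in>A. rk x = s"
      by (meson linorder_neqE_nat)
    then show "A \<in> (\<lambda>z. ?M - {z}) ` ?M \<union> (\<Phi> ` TT \<union> image (flip k m n) ` \<Phi> ` TT)"
    proof cases
      case 1
      then show ?thesis using high[OF A] by blast
    next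
      case (2 x)
      have "s < rk (flip k m n x)" using rk_flip[OF subsetD[OF sub 2(1)]] 2(2) s(4) by linarith
      moreover have "flip k m n x \<in> flip k m n ` A" using 2(1) by blast
      moreover have "card (flip k m n ` A) = card ?M - 1" using A(2) card_flip_image[OF sub] by simp
      ultimately have "flip k m n ` A \<in> \<Phi> ` TT" using high[OF flip_antichain[OF A(1)]] by blast
      then have "flip k m n ` flip k m n ` A \<in> image (flip k m n) ` \<Phi> ` TT" by (rule imageI)
      then show ?thesis unfolding flip_image_flip_image[OF sub] by blast
    next
      case 3
      then have AM: "A \<subseteq> ?M" using sub by (auto simp: level_def)
      have "card (?M - A) = 1"
        using A(2) M_pos AM finite_subset[OF AM finite_level] by (simp add: card_Diff_subset)
      then obtain z where "?M - A = {z}" by (rule card_1_singletonE)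
      then have "A = ?M - {z}" "z \<in> ?M" using AM by blast+
      then show ?thesis by blast
    qed
  qed
  have finZ: "finite Z" unfolding Z_def by (simp add: finite_grid)
  have finT: "finite TT" unfolding TT_def using finZ by simp
  have "card ((\<lambda>z. ?M - {z}) ` ?M \<union> (\<Phi> ` TT \<union> image (flip k m n) ` \<Phi> ` TT)) \<le>
      card ?M + (card TT + card TT)"
    by (intro order_trans[OF card_Un_le] add_mono card_image_le finite_level finT finite_imageI
      order_trans[OF card_image_le card_image_le])
  moreover have "card TT \<le> card Z + 1"
    unfolding TT_def using card_insert_le_m1 card_image_le[OF finZ, of "\<lambda>t. {x \<in> level k m n (s + 1). x \<le> t}"]
    by (metis (no_types, lifting) Suc_eq_plus1 card_insert_if finZ finite_imageI le_SucI not_less_eq_eq)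
  \<comment> \<open>The points \<open>(k, m, n)\<close> and \<open>(k, m, n - 1)\<close> are above
    the middle but on no face. They outweigh the extra element of \<open>TT\<close>, which makes the
    final count strict.\<close>
  moreover have "card Z + 2 \<le> card {t \<in> ?Q. s < rk t}"
  proof -
    have "insert (k, m, n) (insert (k, m, n - 1) Z) \<subseteq> {t \<in> ?Q. s < rk t}"
    proof (intro insert_subsetI)
      show "Z \<subseteq> {t \<in> ?Q. s < rk t}" unfolding Z_def by blast
      have "(k, m, n - 1) \<in> ?Q" "(k, m, n) \<in> ?Q" unfolding in_grid using pos by auto
      moreover have "s < k + m + n" "s < k + m + (n - 1)" using s pos by arith+
      ultimately show "(k, m, n - 1) \<in> {t \<in> ?Q. s < rk t}" "(k, m, n) \<in> {t \<in> ?Q. s < rk t}" by simp_all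
    qed
    moreover have "(k, m, n) \<notin> insert (k, m, n - 1) Z" "(k, m, n - 1) \<notin> Z"
      unfolding Z_def using pos by auto
    then have "card (insert (k, m, n) (insert (k, m, n - 1) Z)) = card Z + 2" using finZ by simp
    ultimately show ?thesis using card_mono[of "{t \<in> ?Q. s < rk t}"] finite_grid by (metis (no_types, lifting) finite_Collect_conjI finite_subset mem_Collect_eq subsetI)
  qed
  moreover have "card {A \<in> antichains ?Q. card A = card ?M - 1} \<le>
      card ((\<lambda>z. ?M - {z}) ` ?M \<union> (\<Phi> ` TT \<union> image (flip k m n) ` \<Phi> ` TT))"
    by (rule card_mono[OF _ cover]) (use finT finite_level in blast)
  moreover have "card {A \<in> antichains ?Q. card A = card ?M - 1} = k * m * n"
  proof -
    from palindromic_second_coeff[OF finite_grid pal level_antichain M_max M_pos]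
    show ?thesis unfolding card_grid .
  qed
  ultimately show False using card_above_level[OF s(4)] by linarith
qed

theorem theorem3p14:
  fixes k m n :: nat
  assumes "1 \<le> k" and "k \<le> m" and "m \<le> n"
  shows "palindromic (antichain_poly (chain_poset k \<times> chain_poset m \<times> chain_poset n)) \<longleftrightarrow>
    (\<exists>r::nat. 1 \<le> r \<and> ((k, m, n) = (1, r, r) \<or> (k, m, n) = (2, r, r + 1)))"
proof
  assume pal: "palindromic (antichain_poly (grid k m n))"
  have "n < k + m" using grid_very_long[of k m n] pal assms by linarith
  moreover have "n = k + m - 1" if "\<not> n + 1 < k + m" using that \<open>n < k + m\<close> by simp
  moreover have False if lt: "n + 1 < k + m" and ev: "even (n + k + m)"
  proof -
    obtain s where s: "k + m + n + 2 = 2 * s"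
      using ev by (intro that[of "(k + m + n + 2) div 2"]) presburger
    show False
      using grid_even_gap[OF _ _ _ s] pal assms lt s by linarith
  qed
  moreover have False if lt: "n + 1 < k + m" and od: "odd (n + k + m)"
  proof -
    obtain q where q: "n + k + m = 2 * q + 1" using od by (rule oddE)
    then have s: "k + m + n + 3 = 2 * (q + 2)" by simp
    \<comment> \<open>Parity excludes \<open>k + m = n + 2\<close>, and this is exactly the slack
      that \<open>n + 3 \<le> s\<close> needs for \<open>s = q + 2\<close>.\<close>
    have "n + 3 \<le> k + m"
    proof (rule ccontr)
      assume "\<not> n + 3 \<le> k + m"
      then have "k + m = n + 2" using lt by simp
      then show False using q by presburger
    qed
    moreover from this have k: "3 \<le> k" using assms by linarith
    ultimately have "k + 3 \<le> m + n" "m + 3 \<le> k + n" "n + 3 \<le> k + m" using assms by simp_all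
    then have "k + 3 \<le> q + 2" "m + 3 \<le> q + 2" "n + 3 \<le> q + 2" using q by simp_all
    then show False
      using grid_odd_gap[OF _ _ _ s] pal k assms by simp
  qed
  ultimately have n: "n = k + m - 1" by blast
  have "k \<le> 2"
  proof (rule ccontr)
    assume "\<not> k \<le> 2"
    then show False using grid_long[of k m] pal assms unfolding n by simp
  qed
  then have "k = 1 \<or> k = 2" using assms(1) by auto
  then show "\<exists>r::nat. 1 \<le> r \<and> ((k, m, n) = (1, r, r) \<or> (k, m, n) = (2, r, r + 1))"
    using assms n by (intro exI[of _ m]) auto
next
  assume "\<exists>r::nat. 1 \<le> r \<and> ((k, m, n) = (1, r, r) \<or> (k, m, n) = (2, r, r + 1))"
  then show "palindromic (antichain_poly (grid k m n))"
    using palindromic_grid_1 palindromic_grid_2 by auto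
qed

end
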